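(* Let $T$ be a nonempty totally ordered set. The following conditions are equivalent: (a) $T\cong \mathrm{Spec}(A_1)$ for some discrete valuation domain $A_1$. (b) $T\cong \mathrm{Spec}(A_2)$ for some commutative valuation ring $A_2$. (c) $T\cong \mathrm{Spec}(A_3)$ for some ring $A_3$ (not necessarily commutative) whose prime spectrum satisfies (K2) and is totally ordered. (d) $T$ is a Dedekind totally ordered set. (e) $T$ satisfies (K1) and (K2). Here $\cong$ means order isomorphism, and (K1), (K2) are the properties of posets defined in the context.
   Context: Rings are associative, nonzero, with identity. $\mathrm{Spec}(A)$ is the set of prime (two-sided) ideals of $A$, ordered by inclusion. In a poset $S$, $a,b$ are immediate neighbors if $a<b$ and there is no $c\in S$ with $a<c<b$. $S$ satisfies (K1) if every nonempty totally ordered subset of $S$ has an infimum and a supremum in $S$. $S$ satisfies (K2) if for all $a<b$ in $S$ there exist $a\le c<d\le b$ in $S$ such that $c$ and $d$ are immediate neighbors in $S$. A cut of a totally ordered set $U$ is a pair $\mathcal A=(\mathcal A^L,\mathcal A^R)$ of disjoint (possibly empty) subsets with union $U$ such that $\alpha<\beta$ for all $\alpha\in\mathcal A^L$, $\beta\in\mathcal A^R$. $D(U)$ is the set of all cuts of $U$ (including $(\emptyset,U)$ and $(U,\emptyset)$; $D(\emptyset)$ has one element), ordered by $\mathcal A\le\mathcal B$ iff $\mathcal A^L\subseteq\mathcal B^L$. A totally ordered set is a Dedekind totally ordered set if it is order isomorphic to $D(U)$ for some totally ordered set $U$ (possibly empty). A commutative valuation ring is a commutative ring whose ideals are totally ordered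 by inclusion. A discrete valuation domain (of arbitrary rank, in the generalized sense) is a valuation domain $O$ such that for each pair of prime ideals $P_1\supset P_2$ that are immediate neighbors in $\mathrm{Spec}(O)$, the ring $(O/P_2)_{P_1/P_2}$ is a discrete rank one valuation domain; equivalently, the isolated (convex) subgroups $H_2\supset H_1$ of the value group corresponding to $P_2, P_1$ satisfy $H_2/H_1\cong\mathbb Z$. A field is regarded as a (trivially discrete) valuation domain. *)

theory Defs
  imports Complex_Main "HOL-Algebra.Ideal_Product" "HOL-Algebra.QuotRing"
begin

text \<open>
  A poset is given by its reflexive order relation \<open>r\<close>; its underlying set is \<open>Field r\<close>.
  Thus \<open>Linear_order r\<close> says that \<open>Field r\<close> is totally ordered by \<open>r\<close>, and the empty relation
  is the empty (totally ordered) poset.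
\<close>

definition order_isomorphic :: "'a rel \<Rightarrow> 'b rel \<Rightarrow> bool" where
  "order_isomorphic r s \<longleftrightarrow>
     (\<exists>f. bij_betw f (Field r) (Field s) \<and>
          (\<forall>x\<in>Field r. \<forall>y\<in>Field r. (x, y) \<in> r \<longleftrightarrow> (f x, f y) \<in> s))"

definition immediate_neighbors :: "'a rel \<Rightarrow> 'a \<Rightarrow> 'a \<Rightarrow> bool" where
  "immediate_neighbors r a b \<longleftrightarrow>
     (a, b) \<in> r \<and> a \<noteq> b \<and>
     \<not> (\<exists>c. (a, c) \<in> r \<and> a \<noteq> c \<and> (c, b) \<in> r \<and> c \<noteq> b)"

definition is_supremum :: "'a rel \<Rightarrow> 'a set \<Rightarrow> 'a \<Rightarrow> bool" where
  "is_supremum r C s \<longleftrightarrow>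
     s \<in> Field r \<and> (\<forall>x\<in>C. (x, s) \<in> r) \<and>
     (\<forall>u\<in>Field r. (\<forall>x\<in>C. (x, u) \<in> r) \<longrightarrow> (s, u) \<in> r)"

definition is_infimum :: "'a rel \<Rightarrow> 'a set \<Rightarrow> 'a \<Rightarrow> bool" where
  "is_infimum r C s \<longleftrightarrow> is_supremum (r\<inverse>) C s"

definition K1 :: "'a rel \<Rightarrow> bool" where
  "K1 r \<longleftrightarrow> (\<forall>C\<in>Chains r. C \<noteq> {} \<longrightarrow> (\<exists>s. is_infimum r C s) \<and> (\<exists>s. is_supremum r C s))"

definition K2 :: "'a rel \<Rightarrow> bool" where
  "K2 r \<longleftrightarrow>
     (\<forall>a b. (a, b) \<in> r \<and> a \<noteq> b \<longrightarrow>
        (\<exists>c d. (a, c) \<in> r \<and> immediate_neighbors r c d \<and> (d, b) \<in> r))"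

definition cuts :: "'a rel \<Rightarrow> ('a set \<times> 'a set) set" where
  "cuts U = {(L, R). L \<inter> R = {} \<and> L \<union> R = Field U \<and>
                     (\<forall>\<alpha>\<in>L. \<forall>\<beta>\<in>R. (\<alpha>, \<beta>) \<in> U \<and> \<alpha> \<noteq> \<beta>)}"

definition cut_order :: "'a rel \<Rightarrow> ('a set \<times> 'a set) rel" where
  "cut_order U = relation_of (\<lambda>A B. fst A \<subseteq> fst B) (cuts U)"

text \<open>
  The library's \<^const>\<open>primeideal\<close> is restricted to commutative rings, so primeness of two-sided
  ideals is defined through products of ideals.
\<close>

definition prime_spectrum :: "('a, 'm) ring_scheme \<Rightarrow> 'a set set" where
  "prime_spectrum R = {P. ideal P R \<and> P \<noteq> carrier R \<and>
     (\<forall>I J. ideal I R \<and> ideal J R \<and> I \<cdot>\<^bsub>R\<^esub> J \<subseteq> P \<longrightarrow> I \<subseteq> P \<or> J \<subseteq> P)}"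

definition spec_order :: "('a, 'm) ring_scheme \<Rightarrow> 'a set rel" where
  "spec_order R = relation_of (\<subseteq>) (prime_spectrum R)"

definition nonzero_ring :: "('a, 'm) ring_scheme \<Rightarrow> bool" where
  "nonzero_ring R \<longleftrightarrow> ring R \<and> \<one>\<^bsub>R\<^esub> \<noteq> \<zero>\<^bsub>R\<^esub>"

definition commutative_valuation_ring :: "('a, 'm) ring_scheme \<Rightarrow> bool" where
  "commutative_valuation_ring R \<longleftrightarrow>
     nonzero_ring R \<and> cring R \<and>
     (\<forall>I J. ideal I R \<and> ideal J R \<longrightarrow> I \<subseteq> J \<or> J \<subseteq> I)"

definition valuation_domain :: "('a, 'm) ring_scheme \<Rightarrow> bool" where
  "valuation_domain R \<longleftrightarrow> domain R \<and> commutative_valuation_ring R"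

text \<open>
  The ring of fractions of a commutative ring \<open>R\<close> with denominators in a multiplicative set \<open>S\<close>,
  realised as equivalence classes of pairs (numerator, denominator).
\<close>

definition fraction_rel :: "('a, 'm) ring_scheme \<Rightarrow> 'a set \<Rightarrow> ('a \<times> 'a) rel" where
  "fraction_rel R S = {((a, s), (b, t)). a \<in> carrier R \<and> s \<in> S \<and> b \<in> carrier R \<and> t \<in> S \<and>
     (\<exists>u\<in>S. u \<otimes>\<^bsub>R\<^esub> (a \<otimes>\<^bsub>R\<^esub> t \<ominus>\<^bsub>R\<^esub> b \<otimes>\<^bsub>R\<^esub> s) = \<zero>\<^bsub>R\<^esub>)}"

definition fraction :: "('a, 'm) ring_scheme \<Rightarrow> 'a set \<Rightarrow> 'a \<Rightarrow> 'a \<Rightarrow> ('a \<times> 'a) set" where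
  "fraction R S a s = fraction_rel R S `` {(a, s)}"

definition ring_of_fractions :: "('a, 'm) ring_scheme \<Rightarrow> 'a set \<Rightarrow> ('a \<times> 'a) set ring" where
  "ring_of_fractions R S =
     \<lparr>carrier = (carrier R \<times> S) // fraction_rel R S,
      mult = (\<lambda>X Y. \<Union>(a, s)\<in>X. \<Union>(b, t)\<in>Y. fraction R S (a \<otimes>\<^bsub>R\<^esub> b) (s \<otimes>\<^bsub>R\<^esub> t)),
      one = fraction R S \<one>\<^bsub>R\<^esub> \<one>\<^bsub>R\<^esub>,
      zero = fraction R S \<zero>\<^bsub>R\<^esub> \<one>\<^bsub>R\<^esub>,
      add = (\<lambda>X Y. \<Union>(a, s)\<in>X. \<Union>(b, t)\<in>Y.
               fraction R S (a \<otimes>\<^bsub>R\<^esub> t \<oplus>\<^bsub>R\<^esub> b \<otimes>\<^bsub>R\<^esub> s) (s \<otimes>\<^bsub>R\<^esub> t))\<rparr>"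

definition localization_at :: "('a, 'm) ring_scheme \<Rightarrow> 'a set \<Rightarrow> ('a \<times> 'a) set ring" where
  "localization_at R P = ring_of_fractions R (carrier R - P)"

definition normalized_discrete_valuation ::
    "('k, 'm) ring_scheme \<Rightarrow> ('k \<Rightarrow> int) \<Rightarrow> bool" where
  "normalized_discrete_valuation K v \<longleftrightarrow>
     (let K' = carrier K - {\<zero>\<^bsub>K\<^esub>} in
        v ` K' = UNIV \<and>
        (\<forall>x\<in>K'. \<forall>y\<in>K'. v (x \<otimes>\<^bsub>K\<^esub> y) = v x + v y) \<and>
        (\<forall>x\<in>K'. \<forall>y\<in>K'. x \<oplus>\<^bsub>K\<^esub> y \<noteq> \<zero>\<^bsub>K\<^esub> \<longrightarrow> min (v x) (v y) \<le> v (x \<oplus>\<^bsub>K\<^esub> y)))"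

text \<open>
  A domain is a discrete rank one valuation domain if it is the valuation ring, inside its field
  of fractions, of a valuation with value group the integers.
\<close>

definition discrete_rank_one_valuation_domain :: "('a, 'm) ring_scheme \<Rightarrow> bool" where
  "discrete_rank_one_valuation_domain R \<longleftrightarrow>
     domain R \<and>
     (let S = carrier R - {\<zero>\<^bsub>R\<^esub>}; K = ring_of_fractions R S in
        \<exists>v. normalized_discrete_valuation K v \<and>
            (\<lambda>a. fraction R S a \<one>\<^bsub>R\<^esub>) ` carrier R =
              {x \<in> carrier K. x = \<zero>\<^bsub>K\<^esub> \<or> 0 \<le> v x})"

text \<open>
  Discreteness in arbitrary rank: for all prime ideals \<open>P2 \<subset> P1\<close> that are immediate neighbors,
  the localization of \<open>R / P2\<close> at \<open>P1 / P2\<close> is discrete of rank one.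
\<close>

definition discrete_valuation_domain :: "('a, 'm) ring_scheme \<Rightarrow> bool" where
  "discrete_valuation_domain R \<longleftrightarrow>
     valuation_domain R \<and>
     (\<forall>P1 P2. immediate_neighbors (spec_order R) P2 P1 \<longrightarrow>
        discrete_rank_one_valuation_domain
          (localization_at (R Quot P2) ((\<lambda>x. P2 +>\<^bsub>R\<^esub> x) ` P1)))"

text \<open>
  HOL cannot quantify existentially over types, so a ring realising a totally ordered set of
  elements of type \<open>'a\<close> has to be sought on a fixed type that is large enough: infinite, and of
  at least the cardinality of \<open>'a\<close>.  The type below, of formal series with rational coefficients
  and exponents in a product of copies of the integers, is one such choice.
\<close>

type_synonym 'a series = "('a \<Rightarrow> int) \<Rightarrow> rat"

end

theory Submission
  imports Defs "HOL-Library.Poly_Mapping"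
begin

text \<open>
  By (K2), an element \<open>t\<close> of \<open>T\<close> is determined by the set of those \<open>d \<le> t\<close> that have an
  immediate predecessor; together with (K1) this makes \<open>T\<close> the set of cuts of the set \<open>U\<close> of all
  elements with an immediate predecessor.

  Conversely, given \<open>U\<close>, order the free abelian group on \<open>U\<close> lexicographically, the least index
  being dominant.  The convex subgroups are the elements supported in a final segment of \<open>U\<close>, so
  every valuation domain with this value group has the cuts of \<open>U\<close> as its spectrum, and successive
  quotients of convex subgroups for immediate neighbors are infinite cyclic.  Such a valuation
  domain is the localization of the group algebra over the rationals, restricted to exponents
  \<open>\<ge> 0\<close>, at the elements with nonzero constant coefficient; by cardinality it embeds into the type
  of series.
\<close>

section \<open>Order theory\<close>

text \<open>What makes the lexicographic group work is that leading indices carry all the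
  information. Nonzero elements of its nonnegative cone with the same leading index are bounded by
  multiples of each other, so in a valuation domain with these values each of two such elements
  divides a power of the other. A prime ideal is therefore recorded by the set of leading indices of
  its elements, and this set is an initial segment. Making the least index dominant is what lets
  inclusion of primes agree with inclusion of the left halves of cuts.

  Finite sums of monomials can replace formal power series: a finite support has a least exponent
  without any well-ordering condition, and once nonzero constant coefficients are inverted, every
  nonzero element is a monomial times a unit, which gives the divisibility that a valuation ring
  needs.

  The ring has to live on one fixed type. For this reason spectrum and discreteness are derived only
  from axioms about a value map, and these axioms are carried along an injection of the ring into
  the type of series.\<close>

lemma Field_relation_of_refl:
  assumes "\<And>x. x \<in> A \<Longrightarrow> P x x"
  shows "Field (relation_of P A) = A"
  using assms by (auto simp: Field_def relation_of_def)

lemma Field_spec_order [simp]: "Field (spec_order R) = prime_spectrum R"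
  unfolding spec_order_def by (rule Field_relation_of_refl) simp

lemma Field_cut_order [simp]: "Field (cut_order U) = cuts U"
  unfolding cut_order_def by (rule Field_relation_of_refl) simp

lemma in_spec_order_iff:
  "(P, Q) \<in> spec_order R \<longleftrightarrow> P \<in> prime_spectrum R \<and> Q \<in> prime_spectrum R \<and> P \<subseteq> Q"
  by (auto simp: spec_order_def relation_of_def)

lemma in_cut_order_iff:
  "(A, B) \<in> cut_order U \<longleftrightarrow> A \<in> cuts U \<and> B \<in> cuts U \<and> fst A \<subseteq> fst B"
  by (auto simp: cut_order_def relation_of_def)

lemma Linear_order_relation_of_inclusion:
  assumes "inj_on f A"
    and "\<And>x y. x \<in> A \<Longrightarrow> y \<in> A \<Longrightarrow> f x \<subseteq> f y \<or> f y \<subseteq> f x"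
  shows "Linear_order (relation_of (\<lambda>x y. f x \<subseteq> f y) A)"
proof -
  have "Field (relation_of (\<lambda>x y. f x \<subseteq> f y) A) = A"
    by (rule Field_relation_of_refl) simp
  with assms show ?thesis
    unfolding linear_order_on_def partial_order_on_def preorder_on_def
      refl_on_def trans_def antisym_def total_on_def relation_of_def inj_on_def
    by auto
qed

lemma Linear_order_refl: "Linear_order r \<Longrightarrow> a \<in> Field r \<Longrightarrow> (a, a) \<in> r"
  by (simp add: linear_order_on_def partial_order_on_def preorder_on_def refl_on_def)

lemma Linear_order_trans: "Linear_order r \<Longrightarrow> (a, b) \<in> r \<Longrightarrow> (b, c) \<in> r \<Longrightarrow> (a, c) \<in> r"
  by (meson linear_order_on_def partial_order_on_def preorder_on_def transD)

lemma Linear_order_antisym: "Linear_order r \<Longrightarrow> (a, b) \<in> r \<Longrightarrow> (b, a) \<in> r \<Longrightarrow> a = b"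
  by (meson linear_order_on_def partial_order_on_def antisymD)

lemma Linear_order_total:
  "Linear_order r \<Longrightarrow> a \<in> Field r \<Longrightarrow> b \<in> Field r \<Longrightarrow> (a, b) \<in> r \<or> (b, a) \<in> r"
  by (metis Linear_order_refl linear_order_on_def total_on_def)

lemma immediate_neighbors_not_rev:
  "Linear_order r \<Longrightarrow> immediate_neighbors r a b \<Longrightarrow> (b, a) \<notin> r"
  by (auto simp: immediate_neighbors_def dest: Linear_order_antisym)

section \<open>Invariance of (K1) and (K2) under order isomorphism\<close>

lemma order_isomorphic_trans:
  assumes "order_isomorphic r s" "order_isomorphic s t" shows "order_isomorphic r t"
proof -
  obtain f where f: "bij_betw f (Field r) (Field s)"
    and fe: "\<And>x y. x \<in> Field r \<Longrightarrow> y \<in> Field r \<Longrightarrow> (x, y) \<in> r \<longleftrightarrow> (f x, f y) \<in> s"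
    using assms unfolding order_isomorphic_def by auto
  obtain g where g: "bij_betw g (Field s) (Field t)"
    and ge: "\<And>x y. x \<in> Field s \<Longrightarrow> y \<in> Field s \<Longrightarrow> (x, y) \<in> s \<longleftrightarrow> (g x, g y) \<in> t"
    using assms unfolding order_isomorphic_def by auto
  have "bij_betw (g \<circ> f) (Field r) (Field t)" using f g by (rule bij_betw_trans)
  moreover have "(x, y) \<in> r \<longleftrightarrow> ((g \<circ> f) x, (g \<circ> f) y) \<in> t"
    if "x \<in> Field r" "y \<in> Field r" for x y
    using that fe ge f by (auto simp: bij_betw_apply)
  ultimately show ?thesis unfolding order_isomorphic_def by blast
qed

lemma Chains_subset_Field: "C \<in> Chains r \<Longrightarrow> C \<subseteq> Field r"
  by (auto simp: Chains_def Field_def)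

lemma is_supremum_order_isomorphic:
  assumes f: "bij_betw f (Field r) (Field s)"
    and e: "\<And>x y. x \<in> Field r \<Longrightarrow> y \<in> Field r \<Longrightarrow> (x, y) \<in> r \<longleftrightarrow> (f x, f y) \<in> s"
    and C: "C \<subseteq> Field r" and m: "m \<in> Field r"
    and sup: "is_supremum s (f ` C) (f m)"
  shows "is_supremum r C m"
proof -
  have fin: "f x \<in> Field s" if "x \<in> Field r" for x using f that by (auto simp: bij_betw_apply)
  show ?thesis unfolding is_supremum_def
  proof (intro conjI ballI impI m)
    fix x assume "x \<in> C"
    then show "(x, m) \<in> r" using sup C m e unfolding is_supremum_def by auto
  next
    fix u assume u: "u \<in> Field r" "\<forall>x\<in>C. (x, u) \<in> r"
    then have "\<forall>x\<in>f ` C. (x, f u) \<in> s" using C e by auto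
    then have "(f m, f u) \<in> s" using sup fin u unfolding is_supremum_def by auto
    then show "(m, u) \<in> r" using e m u by auto
  qed
qed

lemma ex_supremum_order_isomorphic:
  assumes f: "bij_betw f (Field r) (Field s)"
    and e: "\<And>x y. x \<in> Field r \<Longrightarrow> y \<in> Field r \<Longrightarrow> (x, y) \<in> r \<longleftrightarrow> (f x, f y) \<in> s"
    and C: "C \<subseteq> Field r" and sup: "\<exists>m. is_supremum s (f ` C) m"
  shows "\<exists>m. is_supremum r C m"
proof -
  obtain m' where m': "is_supremum s (f ` C) m'" using sup by blast
  then obtain m where "m \<in> Field r" "m' = f m"
    using f unfolding is_supremum_def bij_betw_def by blast
  then show ?thesis using is_supremum_order_isomorphic[OF f e C] m' by blast
qed

lemma K1_order_isomorphic:
  assumes "order_isomorphic r s" "K1 s" shows "K1 r"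
proof -
  obtain f where f: "bij_betw f (Field r) (Field s)"
    and e: "\<And>x y. x \<in> Field r \<Longrightarrow> y \<in> Field r \<Longrightarrow> (x, y) \<in> r \<longleftrightarrow> (f x, f y) \<in> s"
    using assms unfolding order_isomorphic_def by auto
  \<comment> \<open>An infimum is a supremum for the converse relation, so the lemma about suprema,
    applied to the converses, also transports infima.\<close>
  have e': "\<And>x y. x \<in> Field (r\<inverse>) \<Longrightarrow> y \<in> Field (r\<inverse>) \<Longrightarrow> (x, y) \<in> r\<inverse> \<longleftrightarrow> (f x, f y) \<in> s\<inverse>"
    using e by auto
  show ?thesis unfolding K1_def
  proof (intro ballI impI)
    fix C assume C: "C \<in> Chains r" "C \<noteq> {}"
    then have CF: "C \<subseteq> Field r" by (simp add: Chains_subset_Field)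
    then have "f ` C \<in> Chains s" using C e CF unfolding Chains_def by (auto simp: subset_iff)
    with C assms(2) have *: "\<exists>m. is_infimum s (f ` C) m" "\<exists>m. is_supremum s (f ` C) m"
      unfolding K1_def by auto
    show "(\<exists>m. is_infimum r C m) \<and> (\<exists>m. is_supremum r C m)"
      using ex_supremum_order_isomorphic[OF f e CF *(2)]
        ex_supremum_order_isomorphic[of f "r\<inverse>" "s\<inverse>" C] f e' CF *(1)
      unfolding is_infimum_def by auto
  qed
qed

lemma immediate_neighbors_order_isomorphic:
  assumes f: "bij_betw f (Field r) (Field s)"
    and e: "\<And>x y. x \<in> Field r \<Longrightarrow> y \<in> Field r \<Longrightarrow> (x, y) \<in> r \<longleftrightarrow> (f x, f y) \<in> s"
    and ab: "a \<in> Field r" "b \<in> Field r" and n: "immediate_neighbors s (f a) (f b)"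
  shows "immediate_neighbors r a b"
proof -
  have inj: "f x = f y \<longleftrightarrow> x = y" if "x \<in> Field r" "y \<in> Field r" for x y
    using f that unfolding bij_betw_def inj_on_def by auto
  have "(a, c) \<in> r \<and> a \<noteq> c \<and> (c, b) \<in> r \<and> c \<noteq> b \<Longrightarrow>
     (f a, f c) \<in> s \<and> f a \<noteq> f c \<and> (f c, f b) \<in> s \<and> f c \<noteq> f b" for c
    using e inj ab FieldI2[of a c r] by auto
  then show ?thesis using n e inj ab unfolding immediate_neighbors_def by blast
qed

lemma K2_order_isomorphic:
  assumes "order_isomorphic r s" "K2 s" shows "K2 r"
proof -
  obtain f where f: "bij_betw f (Field r) (Field s)"
    and e: "\<And>x y. x \<in> Field r \<Longrightarrow> y \<in> Field r \<Longrightarrow> (x, y) \<in> r \<longleftrightarrow> (f x, f y) \<in> s"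
    using assms unfolding order_isomorphic_def by auto
  show ?thesis unfolding K2_def
  proof (intro allI impI)
    fix a b assume ab: "(a, b) \<in> r \<and> a \<noteq> b"
    then have F: "a \<in> Field r" "b \<in> Field r" by (auto simp: Field_def)
    then have "(f a, f b) \<in> s \<and> f a \<noteq> f b"
      using ab e f unfolding bij_betw_def inj_on_def by auto
    then obtain c' d' where cd': "(f a, c') \<in> s" "immediate_neighbors s c' d'" "(d', f b) \<in> s"
      using assms(2) unfolding K2_def by blast
    then have "c' \<in> Field s" "d' \<in> Field s" by (auto simp: Field_def)
    then obtain c d where cd: "c \<in> Field r" "d \<in> Field r" "c' = f c" "d' = f d"
      using f unfolding bij_betw_def by (metis imageE)
    show "\<exists>c d. (a, c) \<in> r \<and> immediate_neighbors r c d \<and> (d, b) \<in> r"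
      using immediate_neighbors_order_isomorphic[OF f e cd(1,2)] cd cd' e F by blast
  qed
qed

section \<open>Cuts as initial segments; (K1) and (K2) for sets of cuts\<close>

lemma cuts_eqI:
  assumes "A \<in> cuts U" "B \<in> cuts U" "fst A = fst B" shows "A = B"
proof (rule prod_eqI)
  have "snd A = Field U - fst A" "snd B = Field U - fst B"
    using assms(1,2) by (auto simp: cuts_def)
  then show "snd A = snd B" using assms(3) by simp
qed (fact assms(3))

lemma cut_of_initial_segment:
  assumes "Linear_order U" "L \<subseteq> Field U"
    and "\<And>x y. y \<in> L \<Longrightarrow> (x, y) \<in> U \<Longrightarrow> x \<in> L"
  shows "(L, Field U - L) \<in> cuts U"
proof -
  have "(x, y) \<in> U \<and> x \<noteq> y" if "x \<in> L" "y \<in> Field U - L" for x y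
    using that assms(2,3) Linear_order_total[OF assms(1), of x y] by blast
  then show ?thesis using assms(2) by (auto simp: cuts_def)
qed

lemma cuts_down:
  assumes "Linear_order U" "A \<in> cuts U" "y \<in> fst A" "(x, y) \<in> U" shows "x \<in> fst A"
proof -
  have "x \<in> fst A \<or> x \<in> snd A" using assms by (auto simp: cuts_def Field_def)
  moreover have "x \<notin> snd A"
    using assms Linear_order_antisym[OF assms(1)] by (force simp: cuts_def)
  ultimately show ?thesis by blast
qed

lemma fst_cuts_subset: "A \<in> cuts U \<Longrightarrow> fst A \<subseteq> Field U"
  by (auto simp: cuts_def)

lemma ex_cut_fst:
  assumes "Linear_order U" "L \<subseteq> Field U"
    and "\<And>x y. y \<in> L \<Longrightarrow> (x, y) \<in> U \<Longrightarrow> x \<in> L"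
  obtains A where "A \<in> cuts U" "fst A = L"
  using cut_of_initial_segment[of U L] assms that[of "(L, Field U - L)"] by auto

text \<open>Unions and intersections of initial segments are initial segments, and cuts are compared
  by inclusion of their left halves.\<close>

lemma K1_cut_order:
  assumes U: "Linear_order U" shows "K1 (cut_order U)"
  unfolding K1_def
proof (intro ballI impI)
  fix C assume C: "C \<in> Chains (cut_order U)" "C \<noteq> {}"
  then have CF: "C \<subseteq> cuts U" using Chains_subset_Field by fastforce
  have "(\<Inter>A\<in>C. fst A) \<subseteq> Field U" using C(2) CF fst_cuts_subset by blast
  then obtain I where I: "I \<in> cuts U" "fst I = (\<Inter>A\<in>C. fst A)"
    by (rule ex_cut_fst[OF U]) (auto intro: cuts_down[OF U subsetD[OF CF]])
  have "(\<Union>A\<in>C. fst A) \<subseteq> Field U" using CF fst_cuts_subset by blast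
  then obtain S where S: "S \<in> cuts U" "fst S = (\<Union>A\<in>C. fst A)"
    by (rule ex_cut_fst[OF U]) (auto intro: cuts_down[OF U subsetD[OF CF]])
  have "is_infimum (cut_order U) C I"
    unfolding is_infimum_def is_supremum_def using I CF by (auto simp: in_cut_order_iff)
  moreover have "is_supremum (cut_order U) C S"
    unfolding is_supremum_def using S CF by (auto simp: in_cut_order_iff)
  ultimately show "(\<exists>s. is_infimum (cut_order U) C s) \<and> (\<exists>s. is_supremum (cut_order U) C s)"
    by blast
qed

text \<open>Pick u in the left half of B but not of A. The cuts just before and just after u differ
  only by u, so nothing fits between them; A lies below the first because its left half is an
  initial segment that misses u, and B above the second because its left half contains u.\<close>

lemma K2_cut_order:
  assumes U: "Linear_order U" shows "K2 (cut_order U)"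
  unfolding K2_def
proof (intro allI impI)
  fix A B assume AB: "(A, B) \<in> cut_order U \<and> A \<noteq> B"
  then have c: "A \<in> cuts U" "B \<in> cuts U" "fst A \<subseteq> fst B" by (auto simp: in_cut_order_iff)
  then obtain u where u: "u \<in> fst B" "u \<notin> fst A" using cuts_eqI[OF c(1,2)] AB by blast
  have uF: "u \<in> Field U" using u fst_cuts_subset[OF c(2)] by blast
  obtain E where E: "E \<in> cuts U" "fst E = {x. (x, u) \<in> U \<and> x \<noteq> u}"
    by (rule ex_cut_fst[OF U, of "{x. (x, u) \<in> U \<and> x \<noteq> u}"])
      (auto simp: Field_def dest: Linear_order_trans[OF U] Linear_order_antisym[OF U])
  obtain D where D: "D \<in> cuts U" "fst D = {x. (x, u) \<in> U}"
    by (rule ex_cut_fst[OF U, of "{x. (x, u) \<in> U}"])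
      (auto simp: Field_def dest: Linear_order_trans[OF U])
  have "(x, u) \<in> U \<and> x \<noteq> u" if "x \<in> fst A" for x
    using that u uF cuts_down[OF U c(1)] fst_cuts_subset[OF c(1)] Linear_order_total[OF U]
    by (metis subset_iff)
  then have "(A, E) \<in> cut_order U" using c E by (auto simp: in_cut_order_iff)
  moreover have "(D, B) \<in> cut_order U"
    using c D u cuts_down[OF U c(2)] by (auto simp: in_cut_order_iff)
  moreover have "immediate_neighbors (cut_order U) E D"
  proof -
    have uD: "u \<in> fst D" "u \<notin> fst E" using D E uF Linear_order_refl[OF U] by auto
    have DE: "fst D = insert u (fst E)" using D E uF Linear_order_refl[OF U] by auto
    have "E = X \<or> X = D" if "(E, X) \<in> cut_order U" "(X, D) \<in> cut_order U" for X
    proof -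
      have X: "E \<in> cuts U" "X \<in> cuts U" "D \<in> cuts U" "fst E \<subseteq> fst X" "fst X \<subseteq> insert u (fst E)"
        using that DE by (auto simp: in_cut_order_iff)
      then have "fst E = fst X \<or> fst X = fst D" unfolding DE by auto
      then show ?thesis using X cuts_eqI[of E U X] cuts_eqI[of X U D] by blast
    qed
    then show ?thesis using uD DE E D by (auto simp: immediate_neighbors_def in_cut_order_iff)
  qed
  ultimately show "\<exists>c d. (A, c) \<in> cut_order U \<and> immediate_neighbors (cut_order U) c d \<and> (d, B) \<in> cut_order U"
    by blast
qed

text \<open>The choice of \<open>D\<close> is forced: in a set of cuts, the neighbors are the pairs
  of cuts just before and just after an element of U, so U can only reappear as the set of upper
  members of such pairs. (K2) makes the map to cuts an order embedding, (K1) makes it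
  surjective.\<close>

lemma K1_K2_imp_Dedekind:
  fixes T :: "'a rel"
  assumes T: "Linear_order T" and ne: "Field T \<noteq> {}" and K1: "K1 T" and K2: "K2 T"
  obtains U :: "'a rel" where "Linear_order U" "order_isomorphic T (cut_order U)"
proof -
  define D where "D = {d. \<exists>c. immediate_neighbors T c d}"
  define U where "U = {(x, y) \<in> T. x \<in> D \<and> y \<in> D}"
  note refl = Linear_order_refl[OF T] and trans = Linear_order_trans[OF T]
    and antisym = Linear_order_antisym[OF T] and total = Linear_order_total[OF T]
  have DF: "D \<subseteq> Field T" by (auto simp: D_def immediate_neighbors_def Field_def)
  have FU: "Field U = D"
  proof
    show "D \<subseteq> Field U"
    proof
      fix d assume "d \<in> D"
      then have "(d, d) \<in> U" using DF refl by (auto simp: U_def)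
      then show "d \<in> Field U" by (rule FieldI1)
    qed
  qed (auto simp: U_def Field_def)
  have U: "Linear_order U"
    unfolding linear_order_on_def partial_order_on_def preorder_on_def FU
  proof (intro conjI)
    show "refl_on D U" using DF refl unfolding refl_on_def U_def by auto
    show "trans U" using trans unfolding trans_def U_def by blast
    show "antisym U" using antisym unfolding antisym_def U_def by blast
    show "total_on D U" using total DF unfolding total_on_def U_def by blast
    show "U \<subseteq> D \<times> D" unfolding U_def by auto
  qed
  define L where "L t = {d \<in> D. (d, t) \<in> T}" for t
  define f where "f t = (L t, D - L t)" for t
  have fc: "f t \<in> cuts U" for t
  proof -
    have "(L t, Field U - L t) \<in> cuts U"
      by (rule cut_of_initial_segment[OF U]) (auto simp: L_def FU, auto simp: U_def dest: trans)
    then show ?thesis by (simp add: f_def FU)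
  qed
  have L_iff: "L a \<subseteq> L b \<longleftrightarrow> (a, b) \<in> T" if ab: "a \<in> Field T" "b \<in> Field T" for a b
  proof
    assume *: "L a \<subseteq> L b"
    show "(a, b) \<in> T"
    proof (rule ccontr)
      assume n: "(a, b) \<notin> T"
      then have "(b, a) \<in> T" "a \<noteq> b" using total ab refl by auto
      \<comment> \<open>(K2) between b and a yields d in \<open>D\<close> with d \<le> a; if d were
        also below b, then d \<le> b \<le> c, although c is the predecessor of d.\<close>
      then obtain c d where cd: "(b, c) \<in> T" "immediate_neighbors T c d" "(d, a) \<in> T"
        using K2 unfolding K2_def by blast
      then have "d \<in> L a" by (auto simp: L_def D_def)
      then have "(d, b) \<in> T" using * by (auto simp: L_def)
      then have "(d, c) \<in> T" using cd(1) by (rule trans)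
      with cd(2) show False using immediate_neighbors_not_rev[OF T] by blast
    qed
  qed (auto simp: L_def dest: trans)
  have "inj_on f (Field T)"
    by (rule inj_onI) (metis L_iff antisym f_def fst_conv order_refl)
  moreover have "A \<in> f ` Field T" if A: "A \<in> cuts U" for A
  proof -
    have AD: "fst A \<subseteq> D" using fst_cuts_subset[OF A] FU by simp
    have "\<exists>t\<in>Field T. L t = fst A"
    proof (cases "fst A = {}")
      case True
      \<comment> \<open>(K1) gives suprema of nonempty chains only, so the cut with empty left half
        is reached by the least element, the infimum of all of T.\<close>
      have "Field T \<in> Chains T" using total by (auto simp: Chains_def)
      then obtain m where "is_infimum T (Field T) m" using K1 ne unfolding K1_def by blast
      then have m: "m \<in> Field T" "\<And>x. x \<in> Field T \<Longrightarrow> (m, x) \<in> T"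
        unfolding is_infimum_def is_supremum_def by auto
      have "L m = {}"
      proof (rule ccontr)
        assume "L m \<noteq> {}"
        then obtain c d where cd: "immediate_neighbors T c d" "(d, m) \<in> T"
          by (auto simp: L_def D_def)
        have "(m, c) \<in> T" using m(2) cd(1) by (auto simp: immediate_neighbors_def Field_def)
        from cd(2) have "(d, c) \<in> T" using \<open>(m, c) \<in> T\<close> by (rule trans)
        with cd(1) show False using immediate_neighbors_not_rev[OF T] by blast
      qed
      then show ?thesis using m True by auto
    next
      case False
      have "fst A \<in> Chains T" using total subsetD[OF DF] subsetD[OF AD] by (auto simp: Chains_def)
      then obtain m where m: "is_supremum T (fst A) m" using K1 False unfolding K1_def by blast
      have mF: "m \<in> Field T" and mu: "\<And>x. x \<in> fst A \<Longrightarrow> (x, m) \<in> T"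
        and ml: "\<And>u. u \<in> Field T \<Longrightarrow> (\<forall>x\<in>fst A. (x, u) \<in> T) \<Longrightarrow> (m, u) \<in> T"
        using m unfolding is_supremum_def by auto
      \<comment> \<open>The supremum m acquires no new element of \<open>D\<close>: if d \<le> m
        were outside the cut, all of \<open>fst A\<close> would lie below the predecessor c of d,
        hence m \<le> c, contradicting d \<le> m.\<close>
      have "d \<in> fst A" if d: "d \<in> D" "(d, m) \<in> T" for d
      proof (rule ccontr)
        assume nd: "d \<notin> fst A"
        obtain c where c: "immediate_neighbors T c d" using d by (auto simp: D_def)
        then have cF: "c \<in> Field T" "d \<in> Field T" by (auto simp: immediate_neighbors_def Field_def)
        have "(x, c) \<in> T" if x: "x \<in> fst A" for x
        proof -
          have xF: "x \<in> Field T" "x \<in> D" using x AD DF by auto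
          have "\<not> (d, x) \<in> T" using cuts_down[OF U A x, of d] nd d xF by (auto simp: U_def)
          then have "(x, d) \<in> T" "x \<noteq> d" using total xF cF refl by auto
          show ?thesis
          proof (rule ccontr)
            assume "(x, c) \<notin> T"
            then have "(c, x) \<in> T" "c \<noteq> x" using total xF cF refl by auto
            with \<open>(x, d) \<in> T\<close> \<open>x \<noteq> d\<close> c show False by (auto simp: immediate_neighbors_def)
          qed
        qed
        then have "(m, c) \<in> T" using ml cF by auto
        with d(2) have "(d, c) \<in> T" by (rule trans)
        with c show False using immediate_neighbors_not_rev[OF T] by blast
      qed
      then have "L m = fst A" using mu AD by (auto simp: L_def)
      then show ?thesis using mF by blast
    qed
    then obtain t where "t \<in> Field T" "L t = fst A" by blast
    then have "A = f t" using cuts_eqI[OF A fc, of t] by (simp add: f_def)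
    with \<open>t \<in> Field T\<close> show ?thesis by blast
  qed
  ultimately have "bij_betw f (Field T) (Field (cut_order U))"
    using fc by (auto simp: bij_betw_def)
  moreover have "(x, y) \<in> T \<longleftrightarrow> (f x, f y) \<in> cut_order U" if "x \<in> Field T" "y \<in> Field T" for x y
    using L_iff[OF that] fc[of x] fc[of y] unfolding in_cut_order_iff f_def by simp
  ultimately have "order_isomorphic T (cut_order U)"
    unfolding order_isomorphic_def by blast
  with U show ?thesis by (rule that)
qed

section \<open>Prime spectra\<close>

lemma prime_spectrumD:
  assumes "P \<in> prime_spectrum R"
  shows prime_spectrum_ideal: "ideal P R"
    and prime_spectrum_proper: "P \<noteq> carrier R"
    and prime_spectrum_prime:
      "\<And>I J. ideal I R \<Longrightarrow> ideal J R \<Longrightarrow> I \<cdot>\<^bsub>R\<^esub> J \<subseteq> P \<Longrightarrow> I \<subseteq> P \<or> J \<subseteq> P"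
  using assms unfolding prime_spectrum_def by blast+

lemma prime_spectrumI:
  assumes "ideal P R" "P \<noteq> carrier R"
    and "\<And>I J. ideal I R \<Longrightarrow> ideal J R \<Longrightarrow> I \<cdot>\<^bsub>R\<^esub> J \<subseteq> P \<Longrightarrow> I \<subseteq> P \<or> J \<subseteq> P"
  shows "P \<in> prime_spectrum R"
  using assms unfolding prime_spectrum_def by blast

lemma ideal_one_notin:
  assumes "ideal I R" "I \<noteq> carrier R" shows "\<one>\<^bsub>R\<^esub> \<notin> I"
  using ideal.one_imp_carrier assms by blast

text \<open>If I is not contained in P and J is not contained in Q, then the smaller of P and Q
  contains neither, although it contains the product. The argument uses ideals only, so it works
  without commutativity.\<close>

lemma prime_spectrum_Inter_chain:
  assumes R: "ring R" and C: "C \<subseteq> prime_spectrum R" "C \<noteq> {}"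
    and chain: "\<And>P Q. P \<in> C \<Longrightarrow> Q \<in> C \<Longrightarrow> P \<subseteq> Q \<or> Q \<subseteq> P"
  shows "\<Inter>C \<in> prime_spectrum R"
proof (rule prime_spectrumI)
  have id: "ideal P R" if "P \<in> C" for P using that C prime_spectrum_ideal by blast
  show "ideal (\<Inter>C) R" using ring.i_Intersect[OF R] id C(2) by blast
  obtain P where P: "P \<in> C" using C(2) by blast
  then have "P \<in> prime_spectrum R" using C by blast
  then have "\<one>\<^bsub>R\<^esub> \<notin> P" using ideal_one_notin prime_spectrumD(1,2) by blast
  then show "\<Inter>C \<noteq> carrier R" using P ring.ring_simprules(6)[OF R] by blast
next
  fix I J assume IJ: "ideal I R" "ideal J R" "I \<cdot>\<^bsub>R\<^esub> J \<subseteq> \<Inter>C"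
  have pr: "I \<subseteq> P \<or> J \<subseteq> P" if "P \<in> C" for P
    using that IJ C prime_spectrum_prime by blast
  show "I \<subseteq> \<Inter>C \<or> J \<subseteq> \<Inter>C"
  proof (rule ccontr)
    assume "\<not> ?thesis"
    then obtain P Q where PQ: "P \<in> C" "\<not> I \<subseteq> P" "Q \<in> C" "\<not> J \<subseteq> Q" by blast
    show False
    proof (cases "P \<subseteq> Q")
      case True
      then show False using pr[OF PQ(1)] PQ by blast
    next
      case False
      then have "Q \<subseteq> P" using chain PQ by blast
      then show False using pr[OF PQ(3)] PQ by blast
    qed
  qed
qed

text \<open>If neither I nor J is contained in M, both are comaximal with M; multiplying the two
  decompositions of \<one> puts \<one> into the product of I and J plus M.\<close>

lemma maximal_ideal_in_prime_spectrum:
  assumes R: "ring R" and M: "ideal M R" "\<one>\<^bsub>R\<^esub> \<notin> M"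
    and max: "\<And>I. ideal I R \<Longrightarrow> M \<subseteq> I \<Longrightarrow> \<one>\<^bsub>R\<^esub> \<notin> I \<Longrightarrow> I = M"
  shows "M \<in> prime_spectrum R"
proof (rule prime_spectrumI[OF M(1)])
  interpret ring R by fact
  interpret M: ideal M R by fact
  show "M \<noteq> carrier R" using M(2) by blast
  fix I J assume I: "ideal I R" and J: "ideal J R" and IJ: "I \<cdot>\<^bsub>R\<^esub> J \<subseteq> M"
  have one: "\<exists>x\<in>K. \<exists>m\<in>M. \<one>\<^bsub>R\<^esub> = x \<oplus>\<^bsub>R\<^esub> m" if K: "ideal K R" "\<not> K \<subseteq> M" for K
  proof -
    interpret K: ideal K R by fact
    have s: "ideal (K <+>\<^bsub>R\<^esub> M) R" using add_ideals[OF K(1) M(1)] .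
    have "M \<subseteq> K <+>\<^bsub>R\<^esub> M"
    proof
      fix m assume "m \<in> M"
      then have "m = \<zero>\<^bsub>R\<^esub> \<oplus>\<^bsub>R\<^esub> m" by (simp add: M.Icarr)
      then show "m \<in> K <+>\<^bsub>R\<^esub> M" using \<open>m \<in> M\<close> K.zero_closed unfolding set_add_def' by blast
    qed
    moreover have "K \<subseteq> K <+>\<^bsub>R\<^esub> M"
    proof
      fix x assume "x \<in> K"
      then have "x = x \<oplus>\<^bsub>R\<^esub> \<zero>\<^bsub>R\<^esub>" by (simp add: K.Icarr)
      then show "x \<in> K <+>\<^bsub>R\<^esub> M" using \<open>x \<in> K\<close> M.zero_closed unfolding set_add_def' by blast
    qed
    ultimately have "\<one>\<^bsub>R\<^esub> \<in> K <+>\<^bsub>R\<^esub> M" using max[OF s] K(2) by blast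
    then show ?thesis unfolding set_add_def' by blast
  qed
  show "I \<subseteq> M \<or> J \<subseteq> M"
  proof (rule ccontr)
    assume "\<not> ?thesis"
    then obtain i m j n where *: "i \<in> I" "m \<in> M" "\<one>\<^bsub>R\<^esub> = i \<oplus>\<^bsub>R\<^esub> m"
      "j \<in> J" "n \<in> M" "\<one>\<^bsub>R\<^esub> = j \<oplus>\<^bsub>R\<^esub> n"
      using one[OF I] one[OF J] by blast
    have c: "i \<in> carrier R" "j \<in> carrier R" "m \<in> carrier R" "n \<in> carrier R"
      using * ideal.Icarr[OF I] ideal.Icarr[OF J] M.Icarr by auto
    have "\<one>\<^bsub>R\<^esub> = (i \<oplus>\<^bsub>R\<^esub> m) \<otimes>\<^bsub>R\<^esub> (j \<oplus>\<^bsub>R\<^esub> n)" using * by (metis l_one one_closed)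
    also have "\<dots> = i \<otimes>\<^bsub>R\<^esub> j \<oplus>\<^bsub>R\<^esub> (i \<otimes>\<^bsub>R\<^esub> n \<oplus>\<^bsub>R\<^esub> m \<otimes>\<^bsub>R\<^esub> (j \<oplus>\<^bsub>R\<^esub> n))"
      using c by (simp add: l_distr r_distr a_ac)
    also have "\<dots> \<in> M"
      using IJ ideal_prod.prod[of i I j J R] * c M.I_l_closed M.I_r_closed M.a_closed by auto
    finally show False using M(2) by contradiction
  qed
qed

lemma ideal_Union_chain:
  assumes R: "ring R" and C: "C \<noteq> {}" "\<And>I. I \<in> C \<Longrightarrow> ideal I R"
    and chain: "\<And>I J. I \<in> C \<Longrightarrow> J \<in> C \<Longrightarrow> I \<subseteq> J \<or> J \<subseteq> I"
  shows "ideal (\<Union>C) R"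
proof (rule idealI[OF R])
  interpret ring R by fact
  show "subgroup (\<Union>C) (add_monoid R)"
  proof (rule add.subgroupI)
    show "\<Union>C \<subseteq> carrier R" using ideal.Icarr[OF C(2)] by auto
    obtain I where "I \<in> C" using C(1) by blast
    then show "\<Union>C \<noteq> {}" using C(2) additive_subgroup.zero_closed[OF ideal.axioms(1)] by blast
    fix a assume a: "a \<in> \<Union>C"
    show "\<ominus>\<^bsub>R\<^esub> a \<in> \<Union>C"
      using a C(2) by (meson UnionE UnionI additive_subgroup.a_inv_closed ideal.axioms(1))
    fix b assume b: "b \<in> \<Union>C"
    obtain K where "K \<in> C" "a \<in> K" "b \<in> K" using a b chain by blast
    then show "a \<oplus>\<^bsub>R\<^esub> b \<in> \<Union>C"
      using C(2) by (meson UnionI additive_subgroup.a_closed ideal.axioms(1))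
  qed
  fix a x assume "a \<in> \<Union>C" "x \<in> carrier R"
  then show "x \<otimes>\<^bsub>R\<^esub> a \<in> \<Union>C" "a \<otimes>\<^bsub>R\<^esub> x \<in> \<Union>C"
    using C(2) ideal.I_l_closed ideal.I_r_closed by (metis Union_iff)+
qed

text \<open>Zorn's lemma on proper ideals above I. Properness is expressed by the absence of \<one>,
  a form that visibly survives unions of chains.\<close>

lemma ex_prime_spectrum_superset:
  assumes R: "ring R" and I: "ideal I R" "I \<noteq> carrier R"
  shows "\<exists>P\<in>prime_spectrum R. I \<subseteq> P"
proof -
  define \<A> where "\<A> = {J. ideal J R \<and> I \<subseteq> J \<and> \<one>\<^bsub>R\<^esub> \<notin> J}"
  have "I \<in> \<A>" using I ideal_one_notin by (auto simp: \<A>_def)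
  have "\<exists>M\<in>\<A>. \<forall>X\<in>\<A>. M \<subseteq> X \<longrightarrow> X = M"
  proof (rule subset_Zorn_nonempty)
    show "\<A> \<noteq> {}" using \<open>I \<in> \<A>\<close> by blast
    fix C assume C: "C \<noteq> {}" "subset.chain \<A> C"
    then have "C \<subseteq> \<A>" and ch: "\<And>I J. I \<in> C \<Longrightarrow> J \<in> C \<Longrightarrow> I \<subseteq> J \<or> J \<subseteq> I"
      by (auto simp: subset_chain_def)
    have "ideal (\<Union>C) R"
      by (rule ideal_Union_chain[OF R C(1) _ ch]) (use \<open>C \<subseteq> \<A>\<close> in \<open>auto simp: \<A>_def\<close>)
    then show "\<Union>C \<in> \<A>" using \<open>C \<subseteq> \<A>\<close> C(1) unfolding \<A>_def by blast
  qed
  then obtain M where M: "M \<in> \<A>" and max: "\<And>X. X \<in> \<A> \<Longrightarrow> M \<subseteq> X \<Longrightarrow> X = M" by blast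
  have "M \<in> prime_spectrum R"
    by (rule maximal_ideal_in_prime_spectrum[OF R]) (use M max in \<open>auto simp: \<A>_def\<close>)
  then show ?thesis using M by (auto simp: \<A>_def)
qed

text \<open>
  A union of a chain of primes need not be prime in a noncommutative ring: the supremum is
  obtained as the intersection of all primes above the chain.
\<close>

lemma K1_spec_order:
  assumes R: "ring R" and lin: "Linear_order (spec_order R)"
  shows "K1 (spec_order R)"
  unfolding K1_def
proof (intro ballI impI)
  have tot: "P \<subseteq> Q \<or> Q \<subseteq> P" if "P \<in> prime_spectrum R" "Q \<in> prime_spectrum R" for P Q
    using Linear_order_total[OF lin] that by (auto simp: in_spec_order_iff)
  fix C assume "C \<in> Chains (spec_order R)" and ne: "C \<noteq> {}"
  then have C: "C \<subseteq> prime_spectrum R" using Chains_subset_Field by fastforce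
  have inter: "\<Inter>D \<in> prime_spectrum R" if "D \<subseteq> prime_spectrum R" "D \<noteq> {}" for D
    using prime_spectrum_Inter_chain[OF R that] tot that(1) by blast
  have "is_infimum (spec_order R) C (\<Inter>C)"
    unfolding is_infimum_def is_supremum_def
    using inter[OF C ne] C by (auto simp: in_spec_order_iff)
  moreover have "is_supremum (spec_order R) C (\<Inter>{P \<in> prime_spectrum R. \<forall>X\<in>C. X \<subseteq> P})"
  proof -
    have id: "ideal (\<Union>C) R"
      by (rule ideal_Union_chain[OF R ne]) (use C tot prime_spectrum_ideal in blast)+
    have "\<one>\<^bsub>R\<^esub> \<notin> \<Union>C" using C prime_spectrumD(1,2) ideal_one_notin by blast
    then have "\<Union>C \<noteq> carrier R" using ring.ring_simprules(6)[OF R] by blast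
    \<comment> \<open>One prime above the chain makes the family of upper bounds nonempty, as needed
      for its intersection to be a prime.\<close>
    then obtain P where P: "P \<in> prime_spectrum R" "\<Union>C \<subseteq> P"
      using ex_prime_spectrum_superset[OF R id] by blast
    then have "\<Inter>{P \<in> prime_spectrum R. \<forall>X\<in>C. X \<subseteq> P} \<in> prime_spectrum R"
      by (intro inter) auto
    then show ?thesis
      unfolding is_supremum_def using C by (auto simp: in_spec_order_iff)
  qed
  ultimately show "(\<exists>s. is_infimum (spec_order R) C s) \<and> (\<exists>s. is_supremum (spec_order R) C s)"
    by blast
qed

text \<open>Passing from ideals to elements uses principal ideals: (x a)(y b) = (x y)(a b), so if a
  b lies in P, the product of the ideals generated by a and b does too.\<close>

lemma (in cring) prime_spectrum_eq: "prime_spectrum R = {P. primeideal P R}"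
proof (intro equalityI subsetI CollectI)
  fix P assume P: "P \<in> prime_spectrum R"
  interpret P: ideal P R using P by (rule prime_spectrum_ideal)
  show "primeideal P R"
  proof (rule primeidealI[OF P.is_ideal is_cring])
    show "carrier R \<noteq> P" using prime_spectrum_proper[OF P] by blast
    fix a b assume ab: "a \<in> carrier R" "b \<in> carrier R" "a \<otimes> b \<in> P"
    have "(PIdl a) \<cdot> (PIdl b) \<subseteq> P"
    proof
      fix s assume "s \<in> (PIdl a) \<cdot> (PIdl b)"
      then show "s \<in> P"
      proof induct
        case (prod i j)
        then obtain x y where xy: "x \<in> carrier R" "y \<in> carrier R" "i = x \<otimes> a" "j = y \<otimes> b"
          unfolding cgenideal_def by auto
        then have "i \<otimes> j = (x \<otimes> y) \<otimes> (a \<otimes> b)" using ab by (simp add: m_ac)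
        then show ?case using P.I_l_closed[OF ab(3), of "x \<otimes> y"] xy by simp
      qed (rule P.a_closed)
    qed
    then have "PIdl a \<subseteq> P \<or> PIdl b \<subseteq> P"
      using prime_spectrum_prime[OF P] cgenideal_ideal ab by blast
    then show "a \<in> P \<or> b \<in> P" using cgenideal_self ab by blast
  qed
next
  fix P assume "P \<in> {P. primeideal P R}"
  then interpret P: primeideal P R by simp
  show "P \<in> prime_spectrum R"
  proof (rule prime_spectrumI[OF P.is_ideal])
    show "P \<noteq> carrier R" using P.I_notcarr by blast
    fix I J assume IJ: "ideal I R" "ideal J R" "I \<cdot> J \<subseteq> P"
    show "I \<subseteq> P \<or> J \<subseteq> P"
    proof (rule ccontr)
      assume "\<not> ?thesis"
      then obtain i j where ij: "i \<in> I" "i \<notin> P" "j \<in> J" "j \<notin> P" by blast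
      then have "i \<otimes> j \<in> P" using IJ(3) ideal_prod.prod[of i I j J R] by blast
      then show False using P.I_prime ij IJ(1,2) ideal.Icarr by metis
    qed
  qed
qed

section \<open>(K2) for spectra of commutative valuation rings\<close>

lemma commutative_valuation_ringD:
  assumes "commutative_valuation_ring R"
  shows "nonzero_ring R" "cring R" "ring R"
    "\<And>I J. ideal I R \<Longrightarrow> ideal J R \<Longrightarrow> I \<subseteq> J \<or> J \<subseteq> I"
  using assms cring.axioms(1) unfolding commutative_valuation_ring_def by blast+

lemma Linear_order_spec_order:
  assumes "commutative_valuation_ring R" shows "Linear_order (spec_order R)"
  unfolding spec_order_def
  by (rule Linear_order_relation_of_inclusion[where f = "\<lambda>x. x"])
    (use commutative_valuation_ringD(4)[OF assms] prime_spectrum_ideal in \<open>auto simp: inj_on_def\<close>)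

text \<open>
  Between two primes, an element \<open>x\<close> of the larger but not of the smaller one separates two
  immediate neighbors: the largest prime avoiding \<open>x\<close> and the smallest prime containing it.
\<close>

lemma K2_spec_order:
  assumes val: "commutative_valuation_ring R" shows "K2 (spec_order R)"
  unfolding K2_def
proof (intro allI impI)
  note tot = commutative_valuation_ringD(4)[OF val] and R = commutative_valuation_ringD(3)[OF val]
  have cring: "cring R" using val by (rule commutative_valuation_ringD)
  note prime_spectrum_eq = cring.prime_spectrum_eq[OF cring]
  have tot: "P \<subseteq> Q \<or> Q \<subseteq> P" if "P \<in> prime_spectrum R" "Q \<in> prime_spectrum R" for P Q
    using that tot prime_spectrum_ideal by blast
  fix A B assume "(A, B) \<in> spec_order R \<and> A \<noteq> B"
  then have AB: "A \<in> prime_spectrum R" "B \<in> prime_spectrum R" "A \<subseteq> B" "A \<noteq> B"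
    by (auto simp: in_spec_order_iff)
  then obtain x where x: "x \<in> B" "x \<notin> A" by blast
  define C where "C = {P \<in> prime_spectrum R. x \<notin> P}"
  define D where "D = {P \<in> prime_spectrum R. x \<in> P}"
  have AC: "A \<in> C" and BD: "B \<in> D" using AB x by (auto simp: C_def D_def)
  have C: "\<Union>C \<in> prime_spectrum R"
  proof -
    have id: "ideal (\<Union>C) R"
      by (rule ideal_Union_chain[OF R]) (use AC tot prime_spectrum_ideal C_def in blast)+
    have "\<one>\<^bsub>R\<^esub> \<notin> \<Union>C"
      using ideal_one_notin prime_spectrumD(1,2) unfolding C_def by blast
    then have pr: "carrier R \<noteq> \<Union>C" using ring.ring_simprules(6)[OF R] by blast
    \<comment> \<open>Commutativity enters here: primeness can be tested on elements, and that test
      passes to unions of chains.\<close>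
    have "primeideal (\<Union>C) R"
    proof (rule primeidealI[OF id cring pr])
      fix a b assume ab: "a \<in> carrier R" "b \<in> carrier R" "a \<otimes>\<^bsub>R\<^esub> b \<in> \<Union>C"
      then obtain P where P: "P \<in> C" "a \<otimes>\<^bsub>R\<^esub> b \<in> P" by blast
      then have "primeideal P R" using prime_spectrum_eq by (auto simp: C_def)
      from primeideal.I_prime[OF this ab(1,2) P(2)] have "a \<in> P \<or> b \<in> P" .
      then show "a \<in> \<Union>C \<or> b \<in> \<Union>C" using P by blast
    qed
    then show ?thesis using prime_spectrum_eq by blast
  qed
  have D: "\<Inter>D \<in> prime_spectrum R"
    by (rule prime_spectrum_Inter_chain[OF R]) (use BD in \<open>auto simp: D_def dest: tot\<close>)
  have xC: "x \<notin> \<Union>C" and xD: "x \<in> \<Inter>D" by (auto simp: C_def D_def)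
  have CD: "\<Union>C \<subseteq> \<Inter>D" using tot[OF C D] xC xD by blast
  \<comment> \<open>An intermediate prime either contains x and belongs to \<open>D\<close>, or
    avoids x and belongs to \<open>C\<close>; either way it equals an endpoint.\<close>
  have "\<Union>C = P \<or> P = \<Inter>D" if "(\<Union>C, P) \<in> spec_order R" "(P, \<Inter>D) \<in> spec_order R" for P
  proof (cases "x \<in> P")
    case True
    then have "P \<in> D" using that by (auto simp: D_def in_spec_order_iff)
    then show ?thesis using that by (auto simp: in_spec_order_iff)
  next
    case False
    then have "P \<in> C" using that by (auto simp: C_def in_spec_order_iff)
    then show ?thesis using that by (auto simp: in_spec_order_iff)
  qed
  then have "immediate_neighbors (spec_order R) (\<Union>C) (\<Inter>D)"
    using CD C D xC xD unfolding immediate_neighbors_def in_spec_order_iff by blast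
  moreover have "(A, \<Union>C) \<in> spec_order R" "(\<Inter>D, B) \<in> spec_order R"
    using AB C D AC BD by (auto simp: in_spec_order_iff)
  ultimately show "\<exists>c d. (A, c) \<in> spec_order R \<and> immediate_neighbors (spec_order R) c d
      \<and> (d, B) \<in> spec_order R" by blast
qed

section \<open>Rings of fractions of a domain\<close>

lemma (in ring) minus_eq_zero_iff:
  assumes "a \<in> carrier R" "b \<in> carrier R"
  shows "a \<ominus> b = \<zero> \<longleftrightarrow> a = b"
  using assms by (metis a_minus_def a_inv_closed minus_equality minus_minus r_neg)

text \<open>One locale serves fields of fractions, localizations at the complement of a prime, and
  the inversion of nonzero constant coefficients.\<close>

locale domain_fractions = "domain" R for R (structure) +
  fixes S
  assumes S_subset: "S \<subseteq> carrier R" and zero_notin_S: "\<zero> \<notin> S"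
    and one_in_S [simp]: "\<one> \<in> S" and S_mult [simp]: "a \<in> S \<Longrightarrow> b \<in> S \<Longrightarrow> a \<otimes> b \<in> S"
begin

abbreviation frac where "frac \<equiv> fraction R S"
abbreviation F where "F \<equiv> ring_of_fractions R S"

lemma S_carrier [simp]: "s \<in> S \<Longrightarrow> s \<in> carrier R"
  using S_subset by blast

lemma S_nonzero: "s \<in> S \<Longrightarrow> s \<noteq> \<zero>"
  using zero_notin_S by blast

text \<open>The auxiliary factor u is nonzero, so in a domain it cancels and plain cross
  multiplication remains.\<close>

lemma fraction_rel_iff:
  "((a, s), (b, t)) \<in> fraction_rel R S \<longleftrightarrow>
     a \<in> carrier R \<and> s \<in> S \<and> b \<in> carrier R \<and> t \<in> S \<and> a \<otimes> t = b \<otimes> s"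
proof -
  have "(\<exists>u\<in>S. u \<otimes> (a \<otimes> t \<ominus> b \<otimes> s) = \<zero>) \<longleftrightarrow> a \<otimes> t = b \<otimes> s"
    if *: "a \<in> carrier R" "s \<in> S" "b \<in> carrier R" "t \<in> S"
  proof
    assume "\<exists>u\<in>S. u \<otimes> (a \<otimes> t \<ominus> b \<otimes> s) = \<zero>"
    then have "a \<otimes> t \<ominus> b \<otimes> s = \<zero>" using * integral S_nonzero by (metis S_carrier m_closed minus_closed)
    then show "a \<otimes> t = b \<otimes> s" using * by (simp add: minus_eq_zero_iff)
  next
    assume "a \<otimes> t = b \<otimes> s"
    then have "\<one> \<otimes> (a \<otimes> t \<ominus> b \<otimes> s) = \<zero>" using * by (simp add: minus_eq_zero_iff)
    then show "\<exists>u\<in>S. u \<otimes> (a \<otimes> t \<ominus> b \<otimes> s) = \<zero>" using one_in_S by blast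
  qed
  then show ?thesis unfolding fraction_rel_def by blast
qed

lemma cross_trans:
  assumes "a \<in> carrier R" "b \<in> carrier R" "c \<in> carrier R" "s \<in> S" "t \<in> S" "r \<in> S"
    and "a \<otimes> t = b \<otimes> s" "b \<otimes> r = c \<otimes> t"
  shows "a \<otimes> r = c \<otimes> s"
proof -
  have "t \<otimes> (a \<otimes> r) = (a \<otimes> t) \<otimes> r" using assms(1-6) by (simp add: m_ac)
  also have "\<dots> = (b \<otimes> s) \<otimes> r" using assms by simp
  also have "\<dots> = (b \<otimes> r) \<otimes> s" using assms(1-6) by (simp add: m_ac)
  also have "\<dots> = (c \<otimes> t) \<otimes> s" using assms by simp
  also have "\<dots> = t \<otimes> (c \<otimes> s)" using assms(1-6) by (simp add: m_ac)
  finally show ?thesis using assms S_nonzero m_lcancel by simp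
qed

lemma equiv_fraction_rel: "equiv (carrier R \<times> S) (fraction_rel R S)"
proof (rule equivI)
  show "fraction_rel R S \<subseteq> (carrier R \<times> S) \<times> carrier R \<times> S"
    using fraction_rel_iff by auto
  show "refl_on (carrier R \<times> S) (fraction_rel R S)"
    by (auto simp: refl_on_def fraction_rel_iff)
  show "sym (fraction_rel R S)"
    by (auto simp: sym_def fraction_rel_iff)
  show "trans (fraction_rel R S)"
    by (auto simp: trans_def fraction_rel_iff intro: cross_trans)
qed

lemma frac_eq_iff:
  assumes "a \<in> carrier R" "s \<in> S" "b \<in> carrier R" "t \<in> S"
  shows "frac a s = frac b t \<longleftrightarrow> a \<otimes> t = b \<otimes> s"
  using eq_equiv_class_iff[OF equiv_fraction_rel, of "(a, s)" "(b, t)"] assms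
  by (simp add: fraction_def fraction_rel_iff)

lemma in_frac_iff:
  assumes "a \<in> carrier R" "s \<in> S"
  shows "(b, t) \<in> frac a s \<longleftrightarrow> b \<in> carrier R \<and> t \<in> S \<and> frac b t = frac a s"
proof (cases "b \<in> carrier R \<and> t \<in> S")
  case True
  have "(b, t) \<in> frac a s \<longleftrightarrow> a \<otimes> t = b \<otimes> s"
    using assms True unfolding fraction_def by (simp add: fraction_rel_iff)
  also have "\<dots> \<longleftrightarrow> frac b t = frac a s"
    using assms True frac_eq_iff[of a s b t] by auto
  finally show ?thesis using True by simp
next
  case False
  then show ?thesis unfolding fraction_def by (auto simp: fraction_rel_iff)
qed

lemma frac_in_carrier [simp]: "a \<in> carrier R \<Longrightarrow> s \<in> S \<Longrightarrow> frac a s \<in> carrier F"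
  by (auto simp: ring_of_fractions_def fraction_def intro: quotientI)

lemma in_carrier_frac:
  assumes "x \<in> carrier F"
  obtains a s where "a \<in> carrier R" "s \<in> S" "x = frac a s"
  using assms by (auto simp: ring_of_fractions_def fraction_def quotient_def)

text \<open>The operations on fractions are unions over all representatives. If the result is the
  same for all of them, the union over the nonempty classes collapses to that single value.\<close>

lemma UN_frac:
  assumes "a \<in> carrier R" "s \<in> S" "b \<in> carrier R" "t \<in> S"
    and "\<And>a' s' b' t'. a' \<in> carrier R \<Longrightarrow> s' \<in> S \<Longrightarrow> b' \<in> carrier R \<Longrightarrow> t' \<in> S \<Longrightarrow>
      a' \<otimes> s = a \<otimes> s' \<Longrightarrow> b' \<otimes> t = b \<otimes> t' \<Longrightarrow> g a' s' b' t' = g a s b t"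
  shows "(\<Union>(a, s)\<in>frac a s. \<Union>(b, t)\<in>frac b t. g a s b t) = g a s b t"
proof -
  have "g a' s' b' t' = g a s b t" if "(a', s') \<in> frac a s" "(b', t') \<in> frac b t" for a' s' b' t'
  proof -
    have "a' \<in> carrier R" "s' \<in> S" "b' \<in> carrier R" "t' \<in> S"
      "frac a' s' = frac a s" "frac b' t' = frac b t"
      using that assms(1-4) by (simp_all add: in_frac_iff)
    with assms(1-4) show ?thesis by (intro assms(5)) (simp_all add: frac_eq_iff)
  qed
  then have "(\<Union>(a', s')\<in>frac a s. \<Union>(b', t')\<in>frac b t. g a' s' b' t') =
      (\<Union>(a', s')\<in>frac a s. \<Union>(b', t')\<in>frac b t. g a s b t)" by fastforce
  moreover have "(a, s) \<in> frac a s" "(b, t) \<in> frac b t" using assms by (auto simp: in_frac_iff)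
  ultimately show ?thesis by auto
qed

lemma frac_mult:
  assumes "a \<in> carrier R" "s \<in> S" "b \<in> carrier R" "t \<in> S"
  shows "frac a s \<otimes>\<^bsub>F\<^esub> frac b t = frac (a \<otimes> b) (s \<otimes> t)"
proof -
  have "frac (a' \<otimes> b') (s' \<otimes> t') = frac (a \<otimes> b) (s \<otimes> t)"
    if *: "a' \<in> carrier R" "s' \<in> S" "b' \<in> carrier R" "t' \<in> S"
      "a' \<otimes> s = a \<otimes> s'" "b' \<otimes> t = b \<otimes> t'" for a' s' b' t'
  proof -
    have "(a' \<otimes> b') \<otimes> (s \<otimes> t) = (a' \<otimes> s) \<otimes> (b' \<otimes> t)" using *(1-4) assms by (simp add: m_ac)
    also have "\<dots> = (a \<otimes> s') \<otimes> (b \<otimes> t')" using * by simp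
    also have "\<dots> = (a \<otimes> b) \<otimes> (s' \<otimes> t')" using *(1-4) assms by (simp add: m_ac)
    finally show ?thesis using *(1-4) assms by (subst frac_eq_iff) simp_all
  qed
  then show ?thesis
    unfolding ring_of_fractions_def monoid.simps
    by (intro UN_frac[OF assms, of "\<lambda>a s b t. frac (a \<otimes> b) (s \<otimes> t)"])
qed

lemma frac_add:
  assumes "a \<in> carrier R" "s \<in> S" "b \<in> carrier R" "t \<in> S"
  shows "frac a s \<oplus>\<^bsub>F\<^esub> frac b t = frac (a \<otimes> t \<oplus> b \<otimes> s) (s \<otimes> t)"
proof -
  have "frac (a' \<otimes> t' \<oplus> b' \<otimes> s') (s' \<otimes> t') = frac (a \<otimes> t \<oplus> b \<otimes> s) (s \<otimes> t)"
    if *: "a' \<in> carrier R" "s' \<in> S" "b' \<in> carrier R" "t' \<in> S"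
      "a' \<otimes> s = a \<otimes> s'" "b' \<otimes> t = b \<otimes> t'" for a' s' b' t'
  proof -
    have "(a' \<otimes> t' \<oplus> b' \<otimes> s') \<otimes> (s \<otimes> t) = (a' \<otimes> s) \<otimes> (t \<otimes> t') \<oplus> (b' \<otimes> t) \<otimes> (s \<otimes> s')"
      using *(1-4) assms by (simp add: l_distr r_distr m_ac)
    also have "\<dots> = (a \<otimes> s') \<otimes> (t \<otimes> t') \<oplus> (b \<otimes> t') \<otimes> (s \<otimes> s')" using * by simp
    also have "\<dots> = (a \<otimes> t \<oplus> b \<otimes> s) \<otimes> (s' \<otimes> t')" using *(1-4) assms by (simp add: l_distr r_distr m_ac)
    finally show ?thesis using *(1-4) assms by (subst frac_eq_iff) simp_all
  qed
  then show ?thesis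
    unfolding ring_of_fractions_def ring.simps
    by (intro UN_frac[OF assms, of "\<lambda>a s b t. frac (a \<otimes> t \<oplus> b \<otimes> s) (s \<otimes> t)"])
qed

lemma frac_cancel:
  assumes "a \<in> carrier R" "s \<in> S" "r \<in> S"
  shows "frac (a \<otimes> r) (s \<otimes> r) = frac a s"
  using assms by (simp add: frac_eq_iff m_ac)

lemma frac_one: "\<one>\<^bsub>F\<^esub> = frac \<one> \<one>"
  by (simp add: ring_of_fractions_def)

lemma frac_zero: "\<zero>\<^bsub>F\<^esub> = frac \<zero> \<one>"
  by (simp add: ring_of_fractions_def)

lemma frac_eq_zero_iff:
  assumes "a \<in> carrier R" "s \<in> S" shows "frac a s = \<zero>\<^bsub>F\<^esub> \<longleftrightarrow> a = \<zero>"
  using assms by (simp add: frac_zero frac_eq_iff)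

lemma domain_ring_of_fractions: "domain F"
proof (rule domain.intro)
  have "abelian_group F"
  proof (rule abelian_groupI)
    fix x y z assume "x \<in> carrier F" "y \<in> carrier F" "z \<in> carrier F"
    then obtain a s b t c r where *: "a \<in> carrier R" "s \<in> S" "b \<in> carrier R" "t \<in> S"
      "c \<in> carrier R" "r \<in> S" and x: "x = frac a s" "y = frac b t" "z = frac c r"
      by (elim in_carrier_frac) blast
    have "(a \<otimes> t \<oplus> b \<otimes> s) \<otimes> r \<oplus> c \<otimes> (s \<otimes> t) = a \<otimes> (t \<otimes> r) \<oplus> (b \<otimes> r \<oplus> c \<otimes> t) \<otimes> s"
      using * by (simp add: l_distr r_distr m_ac a_ac)
    then show "(x \<oplus>\<^bsub>F\<^esub> y) \<oplus>\<^bsub>F\<^esub> z = x \<oplus>\<^bsub>F\<^esub> (y \<oplus>\<^bsub>F\<^esub> z)"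
      using * by (simp add: x frac_add m_assoc)
  next
    fix x y assume "x \<in> carrier F" "y \<in> carrier F"
    then show "x \<oplus>\<^bsub>F\<^esub> y \<in> carrier F"  "x \<oplus>\<^bsub>F\<^esub> y = y \<oplus>\<^bsub>F\<^esub> x"
      by (auto elim!: in_carrier_frac simp: frac_add m_ac a_ac)
  next
    fix x assume "x \<in> carrier F"
    then obtain a s where as: "a \<in> carrier R" "s \<in> S" "x = frac a s" by (rule in_carrier_frac)
    then show "\<zero>\<^bsub>F\<^esub> \<oplus>\<^bsub>F\<^esub> x = x" by (simp add: frac_add frac_zero)
    have "frac (\<ominus> a) s \<oplus>\<^bsub>F\<^esub> x = \<zero>\<^bsub>F\<^esub>"
      using as by (simp add: frac_add frac_eq_zero_iff l_minus l_neg)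
    then show "\<exists>y\<in>carrier F. y \<oplus>\<^bsub>F\<^esub> x = \<zero>\<^bsub>F\<^esub>" using as by (metis a_inv_closed frac_in_carrier)
  qed (simp add: frac_zero)
  moreover have "comm_monoid F"
    by (rule comm_monoidI) (auto elim!: in_carrier_frac simp: frac_mult frac_one m_ac)
  moreover have "(x \<oplus>\<^bsub>F\<^esub> y) \<otimes>\<^bsub>F\<^esub> z = x \<otimes>\<^bsub>F\<^esub> z \<oplus>\<^bsub>F\<^esub> y \<otimes>\<^bsub>F\<^esub> z"
    if "x \<in> carrier F" "y \<in> carrier F" "z \<in> carrier F" for x y z
  proof -
    from that obtain a s b t c r where *: "a \<in> carrier R" "s \<in> S" "b \<in> carrier R" "t \<in> S"
      "c \<in> carrier R" "r \<in> S" and x: "x = frac a s" "y = frac b t" "z = frac c r"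
      by (elim in_carrier_frac) blast
    \<comment> \<open>Computed directly, the right-hand side of distributivity is the left-hand
      fraction expanded by r; \<open>frac_cancel\<close> removes this factor.\<close>
    have "(a \<otimes> c) \<otimes> (t \<otimes> r) \<oplus> (b \<otimes> c) \<otimes> (s \<otimes> r) = ((a \<otimes> t \<oplus> b \<otimes> s) \<otimes> c) \<otimes> r"
      using * by (simp add: l_distr r_distr m_ac)
    moreover have "(s \<otimes> r) \<otimes> (t \<otimes> r) = ((s \<otimes> t) \<otimes> r) \<otimes> r"
      using * by (simp add: m_ac)
    ultimately show ?thesis using * by (simp add: x frac_add frac_mult frac_cancel)
  qed
  ultimately show "cring F" by (rule cringI)
  show "domain_axioms F"
  proof
    show "\<one>\<^bsub>F\<^esub> \<noteq> \<zero>\<^bsub>F\<^esub>" by (simp add: frac_one frac_eq_zero_iff)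
    fix x y assume "x \<otimes>\<^bsub>F\<^esub> y = \<zero>\<^bsub>F\<^esub>" "x \<in> carrier F" "y \<in> carrier F"
    then show "x = \<zero>\<^bsub>F\<^esub> \<or> y = \<zero>\<^bsub>F\<^esub>"
      by (elim in_carrier_frac) (simp add: frac_mult frac_eq_zero_iff integral_iff)
  qed
qed

end

section \<open>Discrete valuations of rank one\<close>

text \<open>\<open>n\<close> stands for the restriction to the ring of a discrete valuation of its
  field of fractions. Instead of giving zero the value infinity, every law is restricted to nonzero
  elements.\<close>

locale nat_valued_domain = "domain" R for R (structure) +
  fixes n :: "'a \<Rightarrow> nat"
  assumes n_surj: "\<exists>x\<in>carrier R - {\<zero>}. n x = k"
    and n_mult: "x \<in> carrier R - {\<zero>} \<Longrightarrow> y \<in> carrier R - {\<zero>} \<Longrightarrow> n (x \<otimes> y) = n x + n y"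
    and n_add: "x \<in> carrier R - {\<zero>} \<Longrightarrow> y \<in> carrier R - {\<zero>} \<Longrightarrow> x \<oplus> y \<noteq> \<zero> \<Longrightarrow>
      min (n x) (n y) \<le> n (x \<oplus> y)"
begin

lemma n_one: "n \<one> = 0"
  using n_mult[of \<one> \<one>] by simp

lemma mult_nonzero:
  "x \<in> carrier R - {\<zero>} \<Longrightarrow> y \<in> carrier R - {\<zero>} \<Longrightarrow> x \<otimes> y \<in> carrier R - {\<zero>}"
  using integral by auto

text \<open>The valuation extends to fractions by v(a/s) = n a - n s. A fraction with v \<ge> 0
  comes from the ring, because \<open>dvd\<close> then makes s a divisor of a.\<close>

lemma discrete_rank_one:
  assumes dvd: "\<And>x y. x \<in> carrier R - {\<zero>} \<Longrightarrow> y \<in> carrier R - {\<zero>} \<Longrightarrow> n x \<le> n y \<Longrightarrow>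
    \<exists>z\<in>carrier R. y = x \<otimes> z"
  shows "discrete_rank_one_valuation_domain R"
proof -
  define S where "S = carrier R - {\<zero>}"
  interpret fr: domain_fractions R S
    by unfold_locales (auto simp: S_def dest: integral)
  \<comment> \<open>The representative chosen by \<open>SOME\<close> does not matter: a t = b s
    gives n a + n t = n b + n s.\<close>
  define v where "v X = (SOME k. \<exists>a\<in>S. \<exists>s\<in>S. X = fr.frac a s \<and> k = int (n a) - int (n s))" for X
  have v: "v (fr.frac a s) = int (n a) - int (n s)" if as: "a \<in> S" "s \<in> S" for a s
    unfolding v_def
  proof (rule some_equality)
    show "\<exists>b\<in>S. \<exists>t\<in>S. fr.frac a s = fr.frac b t \<and> int (n a) - int (n s) = int (n b) - int (n t)"
      using as by blast
    fix k assume "\<exists>b\<in>S. \<exists>t\<in>S. fr.frac a s = fr.frac b t \<and> k = int (n b) - int (n t)"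
    then obtain b t where bt: "b \<in> S" "t \<in> S" "fr.frac a s = fr.frac b t" "k = int (n b) - int (n t)"
      by blast
    then have "a \<otimes> t = b \<otimes> s" using as by (simp add: fr.frac_eq_iff)
    then have "n a + n t = n b + n s" using n_mult as bt(1,2) unfolding S_def by metis
    then show "k = int (n a) - int (n s)" using bt(4) by linarith
  qed
  have S_iff: "a \<in> S \<longleftrightarrow> a \<in> carrier R \<and> a \<noteq> \<zero>" for a by (auto simp: S_def)
  have mS: "n (x \<otimes> y) = n x + n y" if "x \<in> S" "y \<in> S" for x y
    using n_mult that by (simp add: S_def)
  have frac_nz: "\<exists>a\<in>S. \<exists>s\<in>S. X = fr.frac a s" if "X \<in> carrier fr.F - {\<zero>\<^bsub>fr.F\<^esub>}" for X
  proof -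
    have "X \<in> carrier fr.F" using that by simp
    then obtain a s where as: "a \<in> carrier R" "s \<in> S" "X = fr.frac a s" by (rule fr.in_carrier_frac)
    with that have "a \<in> S" by (auto simp: S_iff fr.frac_eq_zero_iff)
    with as show ?thesis by blast
  qed
  have nz_frac: "fr.frac a s \<in> carrier fr.F - {\<zero>\<^bsub>fr.F\<^esub>}" if "a \<in> S" "s \<in> S" for a s
    using that by (auto simp: fr.frac_eq_zero_iff S_iff[of a])
  have "normalized_discrete_valuation fr.F v"
    unfolding normalized_discrete_valuation_def Let_def
  proof (intro conjI ballI impI)
    show "v ` (carrier fr.F - {\<zero>\<^bsub>fr.F\<^esub>}) = UNIV"
    proof -
      have "k \<in> v ` (carrier fr.F - {\<zero>\<^bsub>fr.F\<^esub>})" for k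
      proof -
        \<comment> \<open>An element x of value |k| gives k through x/1 if k \<ge> 0 and through 1/x
          otherwise.\<close>
        obtain x where x: "x \<in> S" "n x = nat \<bar>k\<bar>" using n_surj unfolding S_def by blast
        have "v (fr.frac x \<one>) = k \<or> v (fr.frac \<one> x) = k"
          using x by (auto simp: v n_one)
        then show ?thesis using nz_frac x by (metis fr.one_in_S imageI)
      qed
      then show ?thesis by blast
    qed
  next
    fix X Y assume "X \<in> carrier fr.F - {\<zero>\<^bsub>fr.F\<^esub>}" "Y \<in> carrier fr.F - {\<zero>\<^bsub>fr.F\<^esub>}"
    then obtain a s b t where *: "a \<in> S" "s \<in> S" "b \<in> S" "t \<in> S"
      and X: "X = fr.frac a s" "Y = fr.frac b t" using frac_nz by meson
    show "v (X \<otimes>\<^bsub>fr.F\<^esub> Y) = v X + v Y"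
      using * by (simp add: X fr.frac_mult v mS)
    assume nz: "X \<oplus>\<^bsub>fr.F\<^esub> Y \<noteq> \<zero>\<^bsub>fr.F\<^esub>"
    have "a \<otimes> t \<oplus> b \<otimes> s \<noteq> \<zero>"
      using nz * by (simp add: X fr.frac_add fr.frac_eq_zero_iff)
    moreover from this have "min (n (a \<otimes> t)) (n (b \<otimes> s)) \<le> n (a \<otimes> t \<oplus> b \<otimes> s)"
      using * by (intro n_add) (auto simp: S_iff dest: integral)
    ultimately show "min (v X) (v Y) \<le> v (X \<oplus>\<^bsub>fr.F\<^esub> Y)"
      using * by (simp add: X fr.frac_add v mS S_iff[of "a \<otimes> t \<oplus> b \<otimes> s"])
  qed
  moreover have "(\<lambda>a. fr.frac a \<one>) ` carrier R = {x \<in> carrier fr.F. x = \<zero>\<^bsub>fr.F\<^esub> \<or> 0 \<le> v x}"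
  proof (intro equalityI subsetI)
    fix x assume "x \<in> (\<lambda>a. fr.frac a \<one>) ` carrier R"
    then obtain a where "a \<in> carrier R" "x = fr.frac a \<one>" by blast
    then show "x \<in> {x \<in> carrier fr.F. x = \<zero>\<^bsub>fr.F\<^esub> \<or> 0 \<le> v x}"
      by (cases "a = \<zero>") (auto simp: fr.frac_eq_zero_iff v S_iff[of a] n_one)
  next
    fix x assume x: "x \<in> {x \<in> carrier fr.F. x = \<zero>\<^bsub>fr.F\<^esub> \<or> 0 \<le> v x}"
    show "x \<in> (\<lambda>a. fr.frac a \<one>) ` carrier R"
    proof (cases "x = \<zero>\<^bsub>fr.F\<^esub>")
      case True
      then show ?thesis by (auto simp: fr.frac_zero)
    next
      case False
      then obtain a s where as: "a \<in> S" "s \<in> S" "x = fr.frac a s" using x frac_nz by blast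
      with x False have "n s \<le> n a" by (simp add: v)
      then obtain z where z: "z \<in> carrier R" "a = s \<otimes> z" using dvd as by (auto simp: S_def)
      then have "x = fr.frac z \<one>" using as by (simp add: fr.frac_eq_iff m_comm)
      then show ?thesis using z by blast
    qed
  qed
  ultimately show ?thesis
    unfolding discrete_rank_one_valuation_domain_def Let_def S_def[symmetric]
    using domain_axioms by blast
qed

text \<open>Denominators have value 0, so \<open>n\<close> extends to the localization by ignoring
  them. Divisibility in the wrong direction, a = b z with n a \<le> n b, forces n z = 0; then z is
  itself a denominator and can be inverted.\<close>

lemma discrete_rank_one_localization:
  assumes Q: "carrier R - Q = {x \<in> carrier R - {\<zero>}. n x = 0}"
    and dvd: "\<And>x y. x \<in> carrier R \<Longrightarrow> y \<in> carrier R \<Longrightarrow>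
      (\<exists>z\<in>carrier R. y = x \<otimes> z) \<or> (\<exists>z\<in>carrier R. x = y \<otimes> z)"
  shows "discrete_rank_one_valuation_domain (localization_at R Q)"
proof -
  define S where "S = carrier R - Q"
  have S_iff: "s \<in> S \<longleftrightarrow> s \<in> carrier R \<and> s \<noteq> \<zero> \<and> n s = 0" for s using Q by (auto simp: S_def)
  interpret fr: domain_fractions R S
    by unfold_locales (auto simp: S_iff n_one n_mult dest: integral)
  define m where "m X = (SOME k. \<exists>a\<in>carrier R - {\<zero>}. \<exists>s\<in>S. X = fr.frac a s \<and> k = n a)" for X
  have m: "m (fr.frac a s) = n a" if as: "a \<in> carrier R - {\<zero>}" "s \<in> S" for a s
    unfolding m_def
  proof (rule some_equality)
    show "\<exists>b\<in>carrier R - {\<zero>}. \<exists>t\<in>S. fr.frac a s = fr.frac b t \<and> n a = n b"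
      using as by blast
    fix k assume "\<exists>b\<in>carrier R - {\<zero>}. \<exists>t\<in>S. fr.frac a s = fr.frac b t \<and> k = n b"
    then obtain b t where bt: "b \<in> carrier R - {\<zero>}" "t \<in> S" "fr.frac a s = fr.frac b t" "k = n b"
      by blast
    then have "a \<otimes> t = b \<otimes> s" using as by (simp add: fr.frac_eq_iff)
    then have "n a + n t = n b + n s" using n_mult as bt(1,2) S_iff by (metis Diff_iff singletonD)
    then show "k = n a" using bt as by (simp add: S_iff)
  qed
  have frac_nz: "\<exists>a\<in>carrier R - {\<zero>}. \<exists>s\<in>S. X = fr.frac a s"
    if "X \<in> carrier fr.F - {\<zero>\<^bsub>fr.F\<^esub>}" for X
  proof -
    have "X \<in> carrier fr.F" using that by simp
    then obtain a s where "a \<in> carrier R" "s \<in> S" "X = fr.frac a s" by (rule fr.in_carrier_frac)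
    with that show ?thesis by (auto simp: fr.frac_eq_zero_iff)
  qed
  interpret loc: "domain" fr.F by (rule fr.domain_ring_of_fractions)
  interpret loc: nat_valued_domain fr.F m
  proof
    fix k
    obtain x where "x \<in> carrier R - {\<zero>}" "n x = k" using n_surj by blast
    then show "\<exists>x\<in>carrier fr.F - {\<zero>\<^bsub>fr.F\<^esub>}. m x = k"
      by (intro bexI[of _ "fr.frac x \<one>"]) (auto simp: m fr.frac_eq_zero_iff)
  next
    fix X Y assume "X \<in> carrier fr.F - {\<zero>\<^bsub>fr.F\<^esub>}" "Y \<in> carrier fr.F - {\<zero>\<^bsub>fr.F\<^esub>}"
    then obtain a s b t where *: "a \<in> carrier R - {\<zero>}" "s \<in> S" "b \<in> carrier R - {\<zero>}" "t \<in> S"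
      and X: "X = fr.frac a s" "Y = fr.frac b t" using frac_nz by meson
    have "X \<otimes>\<^bsub>fr.F\<^esub> Y = fr.frac (a \<otimes> b) (s \<otimes> t)" using * by (simp add: X fr.frac_mult)
    then show "m (X \<otimes>\<^bsub>fr.F\<^esub> Y) = m X + m Y"
      using * m[OF mult_nonzero[OF *(1,3)], of "s \<otimes> t"] by (simp add: X m n_mult)
    assume nz: "X \<oplus>\<^bsub>fr.F\<^esub> Y \<noteq> \<zero>\<^bsub>fr.F\<^esub>"
    have eq: "X \<oplus>\<^bsub>fr.F\<^esub> Y = fr.frac (a \<otimes> t \<oplus> b \<otimes> s) (s \<otimes> t)" using * by (simp add: X fr.frac_add)
    then have nz': "a \<otimes> t \<oplus> b \<otimes> s \<noteq> \<zero>"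
      using nz * by (simp add: fr.frac_eq_zero_iff)
    have st: "s \<in> carrier R - {\<zero>}" "t \<in> carrier R - {\<zero>}" "n s = 0" "n t = 0"
      using * by (auto simp: S_iff)
    have "min (n (a \<otimes> t)) (n (b \<otimes> s)) \<le> n (a \<otimes> t \<oplus> b \<otimes> s)"
      using n_add[OF mult_nonzero mult_nonzero nz'] * st by blast
    then show "min (m X) (m Y) \<le> m (X \<oplus>\<^bsub>fr.F\<^esub> Y)"
      using * st nz' unfolding eq by (simp add: X m n_mult)
  qed
  have "\<exists>Z\<in>carrier fr.F. Y = X \<otimes>\<^bsub>fr.F\<^esub> Z"
    if XY: "X \<in> carrier fr.F - {\<zero>\<^bsub>fr.F\<^esub>}" "Y \<in> carrier fr.F - {\<zero>\<^bsub>fr.F\<^esub>}" "m X \<le> m Y" for X Y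
  proof -
    obtain a s b t where *: "a \<in> carrier R - {\<zero>}" "s \<in> S" "b \<in> carrier R - {\<zero>}" "t \<in> S"
      and X: "X = fr.frac a s" "Y = fr.frac b t" using frac_nz XY(1,2) by meson
    have le: "n a \<le> n b" using XY(3) * by (simp add: X m)
    have c: "a \<in> carrier R" "b \<in> carrier R" using * by auto
    consider z where "z \<in> carrier R" "b = a \<otimes> z" | z where "z \<in> carrier R" "a = b \<otimes> z"
      using dvd[OF c] by blast
    then show ?thesis
    proof cases
      case 1
      then have "Y = X \<otimes>\<^bsub>fr.F\<^esub> fr.frac (z \<otimes> s) t"
        using *(2,4) c by (simp add: X fr.frac_mult fr.frac_eq_iff m_ac)
      then show ?thesis using 1 * by (metis fr.frac_in_carrier fr.S_carrier m_closed)
    next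
      case 2
      then have "z \<noteq> \<zero>" using * by auto
      then have "n a = n b + n z" using 2 * by (simp add: n_mult)
      then have z: "z \<in> S" using le 2 \<open>z \<noteq> \<zero>\<close> by (simp add: S_iff)
      then have "Y = X \<otimes>\<^bsub>fr.F\<^esub> fr.frac s (z \<otimes> t)"
        using 2 *(2,4) c by (simp add: X fr.frac_mult fr.frac_eq_iff m_ac)
      then show ?thesis using z * by (metis fr.frac_in_carrier fr.S_carrier fr.S_mult)
    qed
  qed
  then have "discrete_rank_one_valuation_domain fr.F" by (rule loc.discrete_rank_one)
  then show ?thesis by (simp add: localization_at_def S_def)
qed

end

text \<open>
  The divisibility hypothesis makes \<open>n\<close> constant on the cosets of \<open>P2\<close>.
\<close>

lemma discrete_rank_one_quotient_localization:
  fixes n :: "'a \<Rightarrow> nat" and R (structure)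
  assumes P1: "primeideal P1 R" and P2: "primeideal P2 R" and sub: "P2 \<subseteq> P1"
    and surj: "\<And>k. \<exists>x\<in>carrier R - P2. n x = k"
    and mult: "\<And>x y. x \<in> carrier R - P2 \<Longrightarrow> y \<in> carrier R - P2 \<Longrightarrow> n (x \<otimes> y) = n x + n y"
    and add: "\<And>x y. x \<in> carrier R - P2 \<Longrightarrow> y \<in> carrier R - P2 \<Longrightarrow> x \<oplus> y \<notin> P2 \<Longrightarrow>
      min (n x) (n y) \<le> n (x \<oplus> y)"
    and pos: "\<And>x. x \<in> carrier R - P2 \<Longrightarrow> n x = 0 \<longleftrightarrow> x \<notin> P1"
    and dvd: "\<And>x y. x \<in> carrier R \<Longrightarrow> y \<in> carrier R \<Longrightarrow>
      (\<exists>z\<in>carrier R. y = x \<otimes> z) \<or> (\<exists>z\<in>carrier R. x = y \<otimes> z)"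
  shows "discrete_rank_one_valuation_domain
    (localization_at (R Quot P2) ((\<lambda>x. P2 +> x) ` P1))"
proof -
  interpret R: cring R using P1 by (rule primeideal.axioms(2))
  interpret P1: primeideal P1 R by fact
  interpret P2: primeideal P2 R by fact
  interpret D: "domain" "R Quot P2" by (rule P2.quotient_is_domain)
  interpret h: ring_hom_cring R "R Quot P2" "(+>) P2" by (rule P2.rcos_ring_hom_cring)
  define c where "c = (\<lambda>x. P2 +> x)"
  have c_eq: "c x = c y \<longleftrightarrow> x \<ominus> y \<in> P2" if "x \<in> carrier R" "y \<in> carrier R" for x y
    unfolding c_def using that R.quotient_eq_iff_same_a_r_cos[OF P2.is_ideal] by metis
  have carr: "carrier (R Quot P2) = c ` carrier R"
    unfolding FactRing_def A_RCOSETS_defs c_def a_r_coset_def by auto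
  have zero: "\<zero>\<^bsub>R Quot P2\<^esub> = c \<zero>" unfolding c_def by (simp add: h.hom_zero)
  have c_zero: "c x = \<zero>\<^bsub>R Quot P2\<^esub> \<longleftrightarrow> x \<in> P2" if "x \<in> carrier R" for x
    using that c_eq[of x \<zero>] unfolding zero by (simp add: a_minus_def)
  have c_mult: "c (x \<otimes> y) = c x \<otimes>\<^bsub>R Quot P2\<^esub> c y" if "x \<in> carrier R" "y \<in> carrier R" for x y
    unfolding c_def using that by simp
  have c_add: "c (x \<oplus> y) = c x \<oplus>\<^bsub>R Quot P2\<^esub> c y" if "x \<in> carrier R" "y \<in> carrier R" for x y
    unfolding c_def using that by simp
  have n_coset0: "n x = n y"
    if xy: "x \<in> carrier R - P2" "y \<in> carrier R - P2" "x \<ominus> y \<in> P2"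
      and z: "z \<in> carrier R" "x = y \<otimes> z" for x y z
  proof -
    have "z \<notin> P2" using z xy P2.I_l_closed by blast
    \<comment> \<open>Since y is outside the prime \<open>P2\<close>, the factor z - 1 lies in
      \<open>P2\<close>, hence in \<open>P1\<close>. So z is outside \<open>P1\<close>, has value 0,
      and x = y z has the value of y.\<close>
    have "x \<ominus> y = y \<otimes> (z \<ominus> \<one>)" using z xy
      by (simp add: a_minus_def R.r_distr R.r_minus)
    then have "z \<ominus> \<one> \<in> P2" using P2.I_prime[of y "z \<ominus> \<one>"] xy z by auto
    then have z1: "z \<ominus> \<one> \<in> P1" using sub by blast
    have "z \<notin> P1"
    proof
      assume "z \<in> P1"
      then have "z \<ominus> (z \<ominus> \<one>) \<in> P1" using z1 by (simp add: a_minus_def P1.a_closed P1.a_inv_closed)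
      moreover have "z \<ominus> (z \<ominus> \<one>) = \<one>" using z(1) by (simp add: a_minus_def R.minus_add R.r_neg2)
      ultimately show False using P1.one_imp_carrier P1.I_notcarr by auto
    qed
    then have "n z = 0" using pos \<open>z \<notin> P2\<close> z by blast
    then show ?thesis using mult[of y z] xy z \<open>z \<notin> P2\<close> by simp
  qed
  have n_coset: "n x = n y"
    if xy: "x \<in> carrier R - P2" "y \<in> carrier R - P2" "c x = c y" for x y
  proof -
    have *: "x \<ominus> y \<in> P2" "y \<ominus> x \<in> P2" using xy c_eq[of x y] c_eq[of y x] by auto
    from dvd[of x y] show ?thesis
      using n_coset0[OF xy(1,2) *(1)] n_coset0[OF xy(2,1) *(2)] xy by fastforce
  qed
  define m where "m X = n (SOME x. x \<in> carrier R \<and> X = c x)" for X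
  have m: "m (c x) = n x" if x: "x \<in> carrier R - P2" for x
  proof -
    let ?y = "SOME y. y \<in> carrier R \<and> c x = c y"
    have y: "?y \<in> carrier R" "c x = c ?y" using someI[of "\<lambda>y. y \<in> carrier R \<and> c x = c y" x] x by auto
    then have "?y \<notin> P2" using c_zero x by (metis DiffE)
    then show ?thesis unfolding m_def using n_coset[of ?y x] y x by simp
  qed
  have nz: "\<exists>x\<in>carrier R - P2. X = c x"
    if "X \<in> carrier (R Quot P2) - {\<zero>\<^bsub>R Quot P2\<^esub>}" for X
    using that c_zero unfolding carr by blast
  interpret D: nat_valued_domain "R Quot P2" m
  proof
    fix k
    obtain x where "x \<in> carrier R - P2" "n x = k" using surj by blast
    then show "\<exists>X\<in>carrier (R Quot P2) - {\<zero>\<^bsub>R Quot P2\<^esub>}. m X = k"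
      by (intro bexI[of _ "c x"]) (auto simp: m c_zero carr)
  next
    fix X Y assume "X \<in> carrier (R Quot P2) - {\<zero>\<^bsub>R Quot P2\<^esub>}" "Y \<in> carrier (R Quot P2) - {\<zero>\<^bsub>R Quot P2\<^esub>}"
    then obtain x y where xy: "x \<in> carrier R - P2" "y \<in> carrier R - P2" and X: "X = c x" "Y = c y"
      using nz by meson
    have "x \<otimes> y \<in> carrier R - P2" using xy P2.I_prime by auto
    then show "m (X \<otimes>\<^bsub>R Quot P2\<^esub> Y) = m X + m Y"
      using xy by (simp add: X m mult flip: c_mult)
    assume "X \<oplus>\<^bsub>R Quot P2\<^esub> Y \<noteq> \<zero>\<^bsub>R Quot P2\<^esub>"
    then have "x \<oplus> y \<in> carrier R - P2" using xy c_zero[of "x \<oplus> y"] by (simp add: X c_add)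
    then show "min (m X) (m Y) \<le> m (X \<oplus>\<^bsub>R Quot P2\<^esub> Y)"
      using xy add[of x y] by (simp add: X m flip: c_add)
  qed
  \<comment> \<open>As \<open>P2\<close> is contained in \<open>P1\<close>, the ideal
    \<open>P1\<close> is a union of cosets of \<open>P2\<close>, and its image determines
    it.\<close>
  have mem: "c x \<in> c ` P1 \<longleftrightarrow> x \<in> P1" if "x \<in> carrier R" for x
  proof
    assume "c x \<in> c ` P1"
    then obtain y where y: "y \<in> P1" "c x = c y" by blast
    then have "x \<ominus> y \<in> P1" using c_eq[of x y] that sub P1.Icarr by blast
    then have "(x \<ominus> y) \<oplus> y \<in> P1" using y by (simp add: P1.a_closed)
    then show "x \<in> P1" using that y P1.Icarr by (simp add: a_minus_def R.a_assoc R.l_neg)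
  qed auto
  have "discrete_rank_one_valuation_domain (localization_at (R Quot P2) (c ` P1))"
  proof (rule D.discrete_rank_one_localization)
    show "carrier (R Quot P2) - c ` P1 = {X \<in> carrier (R Quot P2) - {\<zero>\<^bsub>R Quot P2\<^esub>}. m X = 0}"
    proof -
      have "c x \<notin> c ` P1 \<longleftrightarrow> c x \<noteq> \<zero>\<^bsub>R Quot P2\<^esub> \<and> m (c x) = 0" if "x \<in> carrier R" for x
        using mem[OF that] c_zero[OF that] m[of x] pos[of x] sub that by auto
      then have "X \<notin> c ` P1 \<longleftrightarrow> X \<noteq> \<zero>\<^bsub>R Quot P2\<^esub> \<and> m X = 0"
        if "X \<in> carrier (R Quot P2)" for X
        using that unfolding carr by (elim imageE) simp
      then show ?thesis by auto
    qed
    fix X Y assume "X \<in> carrier (R Quot P2)" "Y \<in> carrier (R Quot P2)"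
    then obtain x y where xy: "x \<in> carrier R" "y \<in> carrier R" "X = c x" "Y = c y"
      unfolding carr by blast
    from dvd[OF xy(1,2)]
    show "(\<exists>Z\<in>carrier (R Quot P2). Y = X \<otimes>\<^bsub>R Quot P2\<^esub> Z) \<or>
        (\<exists>Z\<in>carrier (R Quot P2). X = Y \<otimes>\<^bsub>R Quot P2\<^esub> Z)"
    proof (elim disjE bexE)
      fix z assume "z \<in> carrier R" "y = x \<otimes> z"
      then have "c z \<in> carrier (R Quot P2)" "Y = X \<otimes>\<^bsub>R Quot P2\<^esub> c z"
        using xy c_mult carr by auto
      then show ?thesis by blast
    next
      fix z assume "z \<in> carrier R" "x = y \<otimes> z"
      then have "c z \<in> carrier (R Quot P2)" "X = Y \<otimes>\<^bsub>R Quot P2\<^esub> c z"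
        using xy c_mult carr by auto
      then show ?thesis by blast
    qed
  qed
  then show ?thesis by (simp add: c_def)
qed

section \<open>Domains valued in a lexicographic power of the integers\<close>

lemma Linear_order_finite_least:
  assumes linear: "Linear_order U" and "finite A" "A \<noteq> {}" "A \<subseteq> Field U"
  shows "\<exists>u\<in>A. \<forall>x\<in>A. (u, x) \<in> U"
  using assms(2-)
proof (induction rule: finite_ne_induct)
  case (singleton x)
  then show ?case using Linear_order_refl[OF linear] by simp
next
  case (insert x F)
  then obtain u where u: "u \<in> F" "\<forall>x\<in>F. (u, x) \<in> U" by auto
  show ?case
  proof (cases "(u, x) \<in> U")
    case True
    then show ?thesis using u by blast
  next
    case False
    then have "(x, u) \<in> U" using Linear_order_total[OF linear] u insert.prems by blast
    then have "\<forall>y\<in>insert x F. (x, y) \<in> U"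
      using u Linear_order_trans[OF linear] Linear_order_refl[OF linear] insert.prems by blast
    then show ?thesis by blast
  qed
qed

locale lex_order =
  fixes U :: "'a rel"
  assumes linear: "Linear_order U"
begin

definition lead :: "('a \<Rightarrow>\<^sub>0 int) \<Rightarrow> 'a" where
  "lead \<gamma> = (THE u. u \<in> Poly_Mapping.keys \<gamma> \<and> (\<forall>x\<in>Poly_Mapping.keys \<gamma>. (u, x) \<in> U))"

text \<open>The nonnegative cone of the lexicographic order. The order depends on the relation U, so
  \<alpha> \<le> \<beta> is written \<beta> - \<alpha> \<in> \<open>Pos\<close> throughout. The
  guard is there because \<open>lead\<close> is unspecified at 0.\<close>

definition Pos :: "('a \<Rightarrow>\<^sub>0 int) set" where
  "Pos = {\<gamma>. Poly_Mapping.keys \<gamma> \<subseteq> Field U \<and> (\<gamma> \<noteq> 0 \<longrightarrow> Poly_Mapping.lookup \<gamma> (lead \<gamma>) > 0)}"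

lemma lead_eqI:
  assumes "u \<in> Poly_Mapping.keys \<gamma>" "\<And>x. x \<in> Poly_Mapping.keys \<gamma> \<Longrightarrow> (u, x) \<in> U"
  shows "lead \<gamma> = u"
  unfolding lead_def using assms by (blast intro: the_equality Linear_order_antisym[OF linear])

lemma lead_props:
  assumes "\<gamma> \<noteq> 0" "Poly_Mapping.keys \<gamma> \<subseteq> Field U"
  shows "lead \<gamma> \<in> Poly_Mapping.keys \<gamma>" "\<And>x. x \<in> Poly_Mapping.keys \<gamma> \<Longrightarrow> (lead \<gamma>, x) \<in> U"
proof -
  obtain u where "u \<in> Poly_Mapping.keys \<gamma>" "\<forall>x\<in>Poly_Mapping.keys \<gamma>. (u, x) \<in> U"
    using Linear_order_finite_least[OF linear, of "Poly_Mapping.keys \<gamma>"] assms by auto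
  with lead_eqI[of u \<gamma>] show "lead \<gamma> \<in> Poly_Mapping.keys \<gamma>"
    "\<And>x. x \<in> Poly_Mapping.keys \<gamma> \<Longrightarrow> (lead \<gamma>, x) \<in> U" by auto
qed

lemma Pos_keys: "\<gamma> \<in> Pos \<Longrightarrow> Poly_Mapping.keys \<gamma> \<subseteq> Field U"
  by (simp add: Pos_def)

lemma Pos_lead:
  assumes "\<gamma> \<in> Pos" "\<gamma> \<noteq> 0"
  shows "lead \<gamma> \<in> Poly_Mapping.keys \<gamma>" "\<And>x. x \<in> Poly_Mapping.keys \<gamma> \<Longrightarrow> (lead \<gamma>, x) \<in> U"
    "Poly_Mapping.lookup \<gamma> (lead \<gamma>) > 0"
  using assms lead_props by (auto simp: Pos_def)

lemma zero_in_Pos [simp]: "0 \<in> Pos"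
  by (simp add: Pos_def)

lemma in_PosI:
  assumes "Poly_Mapping.keys \<gamma> \<subseteq> Field U" "Poly_Mapping.lookup \<gamma> u > 0"
    and "\<And>x. x \<in> Poly_Mapping.keys \<gamma> \<Longrightarrow> (u, x) \<in> U"
  shows "\<gamma> \<in> Pos" "\<gamma> \<noteq> 0" "lead \<gamma> = u"
proof -
  have "u \<in> Poly_Mapping.keys \<gamma>" using assms(2) by (simp add: in_keys_iff)
  then show "lead \<gamma> = u" using assms(3) by (rule lead_eqI)
  then show "\<gamma> \<in> Pos" using assms by (simp add: Pos_def)
  show "\<gamma> \<noteq> 0" using assms(2) by auto
qed

text \<open>An index below the whole support is either the leading one or carries the coefficient
  0.\<close>

lemma Pos_coeff_nonneg:
  assumes "\<gamma> \<in> Pos" "\<And>x. x \<in> Poly_Mapping.keys \<gamma> \<Longrightarrow> (u, x) \<in> U"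
  shows "Poly_Mapping.lookup \<gamma> u \<ge> 0"
proof (cases "u \<in> Poly_Mapping.keys \<gamma>")
  case True
  then have "lead \<gamma> = u" using assms(2) by (rule lead_eqI)
  then show ?thesis using assms(1) by (cases "\<gamma> = 0") (auto simp: Pos_def)
qed (simp add: in_keys_iff)

lemma single_in_Pos:
  assumes "u \<in> Field U" "k > 0"
  shows "Poly_Mapping.single u k \<in> Pos" "Poly_Mapping.single u k \<noteq> 0"
    "lead (Poly_Mapping.single u k) = u"
  using in_PosI[of "Poly_Mapping.single u k" u] assms Linear_order_refl[OF linear]
  by auto

text \<open>At the smaller lead the coefficient of \<alpha> is positive and that of \<beta> is
  nonnegative, so nothing cancels there.\<close>

lemma Pos_add_aux:
  assumes "\<alpha> \<in> Pos" "\<beta> \<in> Pos" "\<alpha> \<noteq> 0" "\<beta> \<noteq> 0" "(lead \<alpha>, lead \<beta>) \<in> U"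
  shows "\<alpha> + \<beta> \<in> Pos" "\<alpha> + \<beta> \<noteq> 0" "lead (\<alpha> + \<beta>) = lead \<alpha>"
proof -
  have \<beta>: "(lead \<alpha>, x) \<in> U" if "x \<in> Poly_Mapping.keys \<beta>" for x
    using Pos_lead(2)[OF assms(2,4) that] assms(5) Linear_order_trans[OF linear] by blast
  have "Poly_Mapping.lookup (\<alpha> + \<beta>) (lead \<alpha>) > 0"
    using Pos_lead(3)[OF assms(1,3)] Pos_coeff_nonneg[OF assms(2) \<beta>] by (simp add: lookup_add)
  moreover have "Poly_Mapping.keys (\<alpha> + \<beta>) \<subseteq> Field U"
    using keys_add[of \<alpha> \<beta>] Pos_keys[OF assms(1)] Pos_keys[OF assms(2)] by blast
  moreover have "(lead \<alpha>, x) \<in> U" if "x \<in> Poly_Mapping.keys (\<alpha> + \<beta>)" for x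
    using that keys_add[of \<alpha> \<beta>] Pos_lead(2)[OF assms(1,3)] \<beta> by blast
  ultimately show "\<alpha> + \<beta> \<in> Pos" "\<alpha> + \<beta> \<noteq> 0" "lead (\<alpha> + \<beta>) = lead \<alpha>"
    using in_PosI by blast+
qed

lemma Pos_lead_total:
  assumes "\<alpha> \<in> Pos" "\<beta> \<in> Pos" "\<alpha> \<noteq> 0" "\<beta> \<noteq> 0"
  shows "(lead \<alpha>, lead \<beta>) \<in> U \<or> (lead \<beta>, lead \<alpha>) \<in> U"
  using assms Pos_lead(1) Pos_keys Linear_order_total[OF linear] by (meson subsetD)

lemma Pos_add:
  assumes "\<alpha> \<in> Pos" "\<beta> \<in> Pos" shows "\<alpha> + \<beta> \<in> Pos"
proof (cases "\<alpha> = 0 \<or> \<beta> = 0")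
  case False
  then have "\<alpha> \<noteq> 0" "\<beta> \<noteq> 0" by auto
  from Pos_lead_total[OF assms this] show ?thesis
    using Pos_add_aux(1)[OF assms \<open>\<alpha> \<noteq> 0\<close> \<open>\<beta> \<noteq> 0\<close>]
      Pos_add_aux(1)[OF assms(2,1) \<open>\<beta> \<noteq> 0\<close> \<open>\<alpha> \<noteq> 0\<close>] by (auto simp: add.commute)
qed (use assms in auto)

lemma Pos_uminus:
  assumes "\<gamma> \<in> Pos" "- \<gamma> \<in> Pos" shows "\<gamma> = 0"
proof (rule ccontr)
  assume "\<gamma> \<noteq> 0"
  then have "Poly_Mapping.lookup (- \<gamma>) (lead \<gamma>) \<ge> 0"
    using Pos_lead(2)[OF assms(1)] by (intro Pos_coeff_nonneg[OF assms(2)]) simp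
  then show False using Pos_lead(3)[OF assms(1) \<open>\<gamma> \<noteq> 0\<close>] by simp
qed

lemma Pos_antisym:
  assumes "\<alpha> - \<beta> \<in> Pos" "\<beta> - \<alpha> \<in> Pos" shows "\<alpha> = \<beta>"
  using Pos_uminus[of "\<alpha> - \<beta>"] assms by simp

lemma Pos_trans:
  assumes "\<beta> - \<alpha> \<in> Pos" "\<gamma> - \<beta> \<in> Pos" shows "\<gamma> - \<alpha> \<in> Pos"
  using Pos_add[OF assms] by simp

text \<open>The sign of the leading coefficient of the difference decides.\<close>

lemma Pos_total:
  assumes "\<alpha> \<in> Pos" "\<beta> \<in> Pos" shows "\<beta> - \<alpha> \<in> Pos \<or> \<alpha> - \<beta> \<in> Pos"
proof (cases "\<beta> - \<alpha> = 0")
  case False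
  let ?u = "lead (\<beta> - \<alpha>)"
  have k: "Poly_Mapping.keys (\<beta> - \<alpha>) \<subseteq> Field U"
    using keys_diff[of \<beta> \<alpha>] Pos_keys assms by blast
  note l = lead_props[OF False k]
  have k': "Poly_Mapping.keys (\<alpha> - \<beta>) = Poly_Mapping.keys (\<beta> - \<alpha>)"
    by (auto simp: in_keys_iff lookup_minus)
  consider "Poly_Mapping.lookup (\<beta> - \<alpha>) ?u > 0" | "Poly_Mapping.lookup (\<alpha> - \<beta>) ?u > 0"
    using l(1) by (fastforce simp: in_keys_iff lookup_minus)
  then show ?thesis
    by cases (use in_PosI(1)[of _ ?u] k k' l in auto)
qed simp

text \<open>No index of \<alpha> or \<beta> lies below the lead of \<beta>, so a multiple of \<beta>
  exceeds \<alpha> as soon as it does so in the coefficient at that lead.\<close>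

lemma Pos_archimedean:
  assumes "\<alpha> \<in> Pos" "\<beta> \<in> Pos" "\<alpha> \<noteq> 0" "\<beta> \<noteq> 0" "(lead \<beta>, lead \<alpha>) \<in> U"
  shows "\<exists>k::nat. frag_cmul (int k) \<beta> - \<alpha> \<in> Pos"
proof -
  let ?u = "lead \<beta>"
  \<comment> \<open>The leading coefficient of \<beta> is at least 1, so the summand 1 makes the
    comparison strict, also when \<alpha> has coefficient 0 there.\<close>
  define k where "k = nat (Poly_Mapping.lookup \<alpha> ?u) + 1"
  let ?\<gamma> = "frag_cmul (int k) \<beta> - \<alpha>"
  have "Poly_Mapping.lookup \<alpha> ?u < int k" by (simp add: k_def)
  moreover have "int k * 1 \<le> int k * Poly_Mapping.lookup \<beta> ?u"
    using Pos_lead(3)[OF assms(2,4)] by (intro mult_left_mono) auto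
  ultimately have "Poly_Mapping.lookup ?\<gamma> ?u > 0" by (simp add: lookup_minus)
  moreover have ks: "Poly_Mapping.keys ?\<gamma> \<subseteq> Poly_Mapping.keys \<alpha> \<union> Poly_Mapping.keys \<beta>"
    by (auto simp: in_keys_iff lookup_minus)
  moreover have "(?u, x) \<in> U" if "x \<in> Poly_Mapping.keys ?\<gamma>" for x
    using that ks Pos_lead(2)[OF assms(1,3)] Pos_lead(2)[OF assms(2,4)]
      Linear_order_trans[OF linear assms(5)] by blast
  ultimately have "?\<gamma> \<in> Pos" using Pos_keys assms by (intro in_PosI(1)) blast+
  then show ?thesis by blast
qed

text \<open>
  For an initial segment \<open>L\<close> this is the positive part of a convex subgroup, and all convex
  subgroups are of this form.
\<close>

definition initial :: "'a set \<Rightarrow> bool" where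
  "initial L \<longleftrightarrow> (\<forall>y\<in>L. \<forall>x. (x, y) \<in> U \<longrightarrow> x \<in> L)"

lemma initialI: "(\<And>x y. y \<in> L \<Longrightarrow> (x, y) \<in> U \<Longrightarrow> x \<in> L) \<Longrightarrow> initial L"
  by (auto simp: initial_def)

lemma initialD: "initial L \<Longrightarrow> y \<in> L \<Longrightarrow> (x, y) \<in> U \<Longrightarrow> x \<in> L"
  by (auto simp: initial_def)

definition Conv :: "'a set \<Rightarrow> ('a \<Rightarrow>\<^sub>0 int) set" where
  "Conv L = {\<gamma> \<in> Pos. Poly_Mapping.keys \<gamma> \<inter> L = {}}"

lemma zero_in_Conv [simp]: "0 \<in> Conv L"
  by (simp add: Conv_def)

text \<open>If \<alpha> meets the initial segment L, its lead lies in L. The lead of \<alpha> +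
  \<beta> is the smaller of the two leads, hence also in L, so the sum meets L as well.\<close>

lemma Conv_add_aux:
  assumes L: "initial L"
    and "\<alpha> \<in> Pos" "\<beta> \<in> Pos" "\<alpha> + \<beta> \<in> Conv L"
  shows "\<alpha> \<in> Conv L"
proof (rule ccontr)
  assume "\<alpha> \<notin> Conv L"
  then obtain x where x: "x \<in> Poly_Mapping.keys \<alpha>" "x \<in> L" using assms by (auto simp: Conv_def)
  then have \<alpha>: "\<alpha> \<noteq> 0" by auto
  then have l: "lead \<alpha> \<in> L" using Pos_lead(2)[OF assms(2) \<alpha> x(1)] initialD[OF L x(2)] by blast
  have "\<beta> \<noteq> 0" using assms(4) x by (auto simp: Conv_def)
  then have "\<alpha> + \<beta> \<noteq> 0 \<and> lead (\<alpha> + \<beta>) \<in> L"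
    using Pos_lead_total[OF assms(2,3) \<alpha>] Pos_add_aux[OF assms(2,3) \<alpha>]
      Pos_add_aux[OF assms(3,2) _ \<alpha>] initialD[OF L l] l by (auto simp: add.commute)
  then show False using Pos_lead(1)[OF Pos_add[OF assms(2,3)]] assms(4) by (auto simp: Conv_def)
qed

lemma Conv_add:
  assumes "initial L" and "\<alpha> \<in> Pos" "\<beta> \<in> Pos"
  shows "\<alpha> + \<beta> \<in> Conv L \<longleftrightarrow> \<alpha> \<in> Conv L \<and> \<beta> \<in> Conv L"
proof
  assume *: "\<alpha> + \<beta> \<in> Conv L"
  then have "\<beta> + \<alpha> \<in> Conv L" by (simp add: add.commute)
  with * show "\<alpha> \<in> Conv L \<and> \<beta> \<in> Conv L"
    using Conv_add_aux[OF assms(1)] assms(2,3) by blast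
next
  assume "\<alpha> \<in> Conv L \<and> \<beta> \<in> Conv L"
  then show "\<alpha> + \<beta> \<in> Conv L"
    using keys_add[of \<alpha> \<beta>] Pos_add[OF assms(2,3)] unfolding Conv_def by blast
qed

end

text \<open>A value map onto the cone, with \<open>w_dvd\<close> saying that the ring is the full
  valuation ring: comparison of values is divisibility. Only ring operations and \<open>w\<close>
  occur, so the axioms can be moved to a ring on another type.\<close>

locale lex_valued_domain = lex_order U + "domain" R
  for U :: "'a rel" and R :: "('r, 'm) ring_scheme" (structure) +
  fixes w :: "'r \<Rightarrow> ('a \<Rightarrow>\<^sub>0 int)"
  assumes w_Pos: "x \<in> carrier R - {\<zero>} \<Longrightarrow> w x \<in> Pos"
    and w_surj: "\<gamma> \<in> Pos \<Longrightarrow> \<exists>x\<in>carrier R - {\<zero>}. w x = \<gamma>"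
    and w_mult: "x \<in> carrier R - {\<zero>} \<Longrightarrow> y \<in> carrier R - {\<zero>} \<Longrightarrow> w (x \<otimes> y) = w x + w y"
    and w_add: "x \<in> carrier R - {\<zero>} \<Longrightarrow> y \<in> carrier R - {\<zero>} \<Longrightarrow> x \<oplus> y \<noteq> \<zero> \<Longrightarrow>
      w (x \<oplus> y) - w x \<in> Pos \<or> w (x \<oplus> y) - w y \<in> Pos"
    and w_dvd: "x \<in> carrier R - {\<zero>} \<Longrightarrow> y \<in> carrier R - {\<zero>} \<Longrightarrow> w y - w x \<in> Pos \<Longrightarrow>
      \<exists>z\<in>carrier R. y = x \<otimes> z"
begin

section \<open>Prime ideals of a lexicographically valued domain\<close>

lemma w_one: "w \<one> = 0"
  using w_mult[of \<one> \<one>] by simp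

lemma mult_nonzero:
  "x \<in> carrier R - {\<zero>} \<Longrightarrow> y \<in> carrier R - {\<zero>} \<Longrightarrow> x \<otimes> y \<in> carrier R - {\<zero>}"
  using integral by auto

lemma dvd_total:
  assumes "x \<in> carrier R" "y \<in> carrier R"
  shows "(\<exists>z\<in>carrier R. y = x \<otimes> z) \<or> (\<exists>z\<in>carrier R. x = y \<otimes> z)"
proof (cases "x = \<zero> \<or> y = \<zero>")
  case True
  then have "y = x \<otimes> \<zero> \<or> x = y \<otimes> \<zero>" using assms by auto
  then show ?thesis by blast
next
  case False
  then have "x \<in> carrier R - {\<zero>}" "y \<in> carrier R - {\<zero>}" using assms by auto
  then show ?thesis using Pos_total[OF w_Pos w_Pos] w_dvd by blast
qed

lemma ideals_total:
  assumes I: "ideal I R" and J: "ideal J R" shows "I \<subseteq> J \<or> J \<subseteq> I"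
proof (rule ccontr)
  assume "\<not> ?thesis"
  then obtain x y where xy: "x \<in> I" "x \<notin> J" "y \<in> J" "y \<notin> I" by blast
  have "x \<in> carrier R" "y \<in> carrier R" using xy ideal.Icarr[OF I] ideal.Icarr[OF J] by auto
  from dvd_total[OF this] show False
    using xy ideal.I_r_closed[OF I] ideal.I_r_closed[OF J] by blast
qed

lemma valuation_domain: "valuation_domain R"
  unfolding valuation_domain_def commutative_valuation_ring_def nonzero_ring_def
  using domain_axioms ring_axioms is_cring ideals_total by simp

text \<open>The prime attached to a convex subgroup consists of zero and the elements with value
  outside it. Larger L means a smaller subgroup and a larger prime, so the two reversals
  cancel.\<close>

definition prime_of :: "'a set \<Rightarrow> 'r set" where
  "prime_of L = {x \<in> carrier R. x = \<zero> \<or> w x \<notin> Conv L}"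

text \<open>Both directions of \<open>Conv_add\<close> are used: a sum of values in
  \<open>Conv L\<close> has both summands there, which gives closure under multiplication by the
  ring; the converse gives primeness.\<close>

lemma primeideal_prime_of:
  assumes L: "initial L"
  shows "primeideal (prime_of L) R"
proof -
  have mult: "r \<otimes> x \<in> prime_of L" if "x \<in> prime_of L" "r \<in> carrier R" for x r
  proof (cases "x = \<zero> \<or> r = \<zero>")
    case True
    then show ?thesis using that by (auto simp: prime_of_def)
  next
    case False
    then have xr: "x \<in> carrier R - {\<zero>}" "r \<in> carrier R - {\<zero>}"
      using that by (auto simp: prime_of_def)
    then show ?thesis
      using Conv_add[OF L w_Pos[OF xr(2)] w_Pos[OF xr(1)]] w_mult[OF xr(2,1)] that False
      by (auto simp: prime_of_def)
  qed
  have id: "ideal (prime_of L) R"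
  proof (rule idealI[OF ring_axioms])
    show "subgroup (prime_of L) (add_monoid R)"
    proof (rule add.subgroupI)
      show "prime_of L \<subseteq> carrier R" by (auto simp: prime_of_def)
      show "prime_of L \<noteq> {}" by (auto simp: prime_of_def)
      fix x assume x: "x \<in> prime_of L"
      \<comment> \<open>Writing the negative as a multiple by -1 avoids computing the value of a
        negative.\<close>
      then have "\<ominus> x = \<ominus> \<one> \<otimes> x" by (simp add: prime_of_def l_minus)
      then show "\<ominus> x \<in> prime_of L" using mult[OF x, of "\<ominus> \<one>"] by simp
      fix y assume y: "y \<in> prime_of L"
      show "x \<oplus> y \<in> prime_of L"
      proof (cases "x = \<zero> \<or> y = \<zero> \<or> x \<oplus> y = \<zero>")
        case True
        then show ?thesis using x y by (auto simp: prime_of_def)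
      next
        case False
        then have xy: "x \<in> carrier R - {\<zero>}" "y \<in> carrier R - {\<zero>}"
          using x y by (auto simp: prime_of_def)
        have "\<exists>z\<in>{x, y}. w (x \<oplus> y) - w z \<in> Pos" using w_add[OF xy] False by blast
        then obtain z where z: "z \<in> {x, y}" "w (x \<oplus> y) - w z \<in> Pos" by blast
        have "w z \<in> Pos" "w z \<notin> Conv L" using z xy x y w_Pos by (auto simp: prime_of_def)
        \<comment> \<open>The value of the sum is that of z plus an element of the cone; were it in
          \<open>Conv L\<close>, the value of z would be too.\<close>
        then have "w (x \<oplus> y) \<notin> Conv L" using Conv_add[OF L, where \<alpha> = "w z" and \<beta> = "w (x \<oplus> y) - w z"] z(2) by simp
        then show ?thesis using xy by (auto simp: prime_of_def)
      qed
    qed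
    fix a x assume "a \<in> prime_of L" "x \<in> carrier R"
    then show "x \<otimes> a \<in> prime_of L" "a \<otimes> x \<in> prime_of L"
      using mult[of a x] m_comm[of a x] by (auto simp: prime_of_def)
  qed
  show ?thesis
  proof (rule primeidealI[OF id is_cring])
    have "\<one> \<notin> prime_of L" by (simp add: prime_of_def w_one)
    then show "carrier R \<noteq> prime_of L" by blast
    fix a b assume ab: "a \<in> carrier R" "b \<in> carrier R" "a \<otimes> b \<in> prime_of L"
    show "a \<in> prime_of L \<or> b \<in> prime_of L"
    proof (rule ccontr)
      assume "\<not> ?thesis"
      then have *: "a \<in> carrier R - {\<zero>}" "b \<in> carrier R - {\<zero>}" "w a \<in> Conv L" "w b \<in> Conv L"
        using ab by (auto simp: prime_of_def)
      then have "w (a \<otimes> b) \<in> Conv L" using Conv_add[OF L w_Pos w_Pos] by (simp add: w_mult)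
      then show False using mult_nonzero[OF *(1,2)] ab by (auto simp: prime_of_def)
    qed
  qed
qed

text \<open>For u in the field of U, an element of value \<open>single u 1\<close> lies in the prime
  of a segment exactly when u is in that segment, so segments can be read off from primes.\<close>

lemma prime_of_subset_iff:
  assumes "L \<subseteq> Field U" shows "prime_of L \<subseteq> prime_of L' \<longleftrightarrow> L \<subseteq> L'"
proof
  assume *: "prime_of L \<subseteq> prime_of L'"
  show "L \<subseteq> L'"
  proof
    fix u assume u: "u \<in> L"
    then obtain x where x: "x \<in> carrier R - {\<zero>}" "w x = Poly_Mapping.single u 1"
      using w_surj[OF single_in_Pos(1)[of u 1]] assms by auto
    then have "x \<in> prime_of L" using u by (simp add: prime_of_def Conv_def)
    then have "x \<in> prime_of L'" using * by blast
    then have "w x \<notin> Conv L'" using x(1) by (simp add: prime_of_def)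
    then show "u \<in> L'" using x w_Pos[OF x(1)] by (auto simp: Conv_def)
  qed
qed (auto simp: prime_of_def Conv_def)

lemma w_pow:
  assumes "x \<in> carrier R - {\<zero>}"
  shows "x [^] (k::nat) \<in> carrier R - {\<zero>} \<and> w (x [^] k) = frag_cmul (int k) (w x)"
proof (induction k)
  case 0
  have "frag_cmul 0 (w x) = 0" by simp
  then show ?case by (simp add: w_one)
next
  case (Suc k)
  have "frag_cmul (int (Suc k)) (w x) = frag_cmul (int k) (w x) + w x"
    by (rule poly_mapping_eqI) (simp add: lookup_add algebra_simps)
  then show ?case using Suc mult_nonzero[of "x [^] k" x] assms w_mult[of "x [^] k" x] by simp
qed

text \<open>By \<open>Pos_archimedean\<close> some power of y has value at least that of x, so x
  divides it and primeness gives y. Hence membership of a nonzero nonunit in a prime depends only on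
  its leading index.\<close>

lemma primeideal_lead_closed:
  assumes P: "primeideal P R" and x: "x \<in> P" "x \<noteq> \<zero>" "w x \<noteq> 0"
    and y: "y \<in> carrier R - {\<zero>}" "w y \<noteq> 0" "(lead (w y), lead (w x)) \<in> U"
  shows "y \<in> P"
proof -
  interpret P: primeideal P R by fact
  have xc: "x \<in> carrier R - {\<zero>}" using x P.Icarr by blast
  obtain k where k: "frag_cmul (int k) (w y) - w x \<in> Pos"
    using Pos_archimedean[OF w_Pos[OF xc] w_Pos[OF y(1)] x(3) y(2,3)] by blast
  then obtain z where z: "z \<in> carrier R" "y [^] k = x \<otimes> z"
    using w_dvd[of x "y [^] k"] xc w_pow[OF y(1), of k] by auto
  then have "y [^] k \<in> P" using x P.I_r_closed by simp
  moreover have "y [^] k \<in> P \<Longrightarrow> y \<in> P" for k :: nat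
  proof (induction k)
    case 0
    then show ?case using P.one_imp_carrier P.I_notcarr by simp
  next
    case (Suc k)
    then show ?case using P.I_prime[of "y [^] k" y] y by auto
  qed
  ultimately show ?thesis by blast
qed

lemma primeideal_eq_prime_of:
  assumes P: "primeideal P R"
  obtains L where "L \<subseteq> Field U" "initial L" "P = prime_of L"
proof -
  interpret P: primeideal P R by fact
  define L where "L = (\<lambda>x. lead (w x)) ` (P - {\<zero>})"
  have c: "x \<in> carrier R - {\<zero>}" if "x \<in> P - {\<zero>}" for x using that P.Icarr by blast
  \<comment> \<open>An element of value 0 divides \<one>, so a proper ideal contains none, and every
    \<open>lead\<close> in the definition of \<open>L\<close> is meaningful.\<close>
  have nz: "w x \<noteq> 0" if x: "x \<in> P - {\<zero>}" for x
  proof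
    assume "w x = 0"
    then obtain z where "z \<in> carrier R" "\<one> = x \<otimes> z" using w_dvd[OF c[OF x], of \<one>] w_one by auto
    then have "\<one> \<in> P" using x P.I_r_closed by auto
    then show False using P.one_imp_carrier P.I_notcarr by simp
  qed
  have LF: "L \<subseteq> Field U"
    using Pos_lead(1)[OF w_Pos[OF c] nz] Pos_keys[OF w_Pos[OF c]] unfolding L_def by blast
  have L: "initial L"
  proof (rule initialI)
    fix x y assume "y \<in> L" and xy: "(x, y) \<in> U"
    obtain p where p: "p \<in> P - {\<zero>}" "y = lead (w p)" using \<open>y \<in> L\<close> by (auto simp: L_def)
    have xF: "x \<in> Field U" using xy by (rule FieldI1)
    then obtain q where q: "q \<in> carrier R - {\<zero>}" "w q = Poly_Mapping.single x 1"
      using w_surj[OF single_in_Pos(1)[of x 1]] by auto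
    have lq: "w q \<noteq> 0" "lead (w q) = x" using single_in_Pos[OF xF, of 1] q by auto
    then have "(lead (w q), lead (w p)) \<in> U" using xy p(2) by simp
    then have "q \<in> P" using primeideal_lead_closed[OF P _ _ nz[OF p(1)] q(1) lq(1)] p(1) by simp
    then show "x \<in> L" using q lq unfolding L_def by blast
  qed
  have "P = prime_of L"
  proof (intro equalityI subsetI)
    fix x assume x: "x \<in> P"
    show "x \<in> prime_of L"
    proof (cases "x = \<zero>")
      case False
      with x have x': "x \<in> P - {\<zero>}" by simp
      then have "lead (w x) \<in> L" by (auto simp: L_def)
      moreover have "lead (w x) \<in> Poly_Mapping.keys (w x)"
        using Pos_lead(1)[OF w_Pos[OF c[OF x']] nz[OF x']] .
      ultimately show ?thesis using c[OF x'] by (auto simp: prime_of_def Conv_def)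
    qed (simp add: prime_of_def)
  next
    fix x assume x: "x \<in> prime_of L"
    show "x \<in> P"
    proof (cases "x = \<zero>")
      case False
      with x have xc: "x \<in> carrier R - {\<zero>}" "w x \<notin> Conv L" by (auto simp: prime_of_def)
      then obtain u where u: "u \<in> Poly_Mapping.keys (w x)" "u \<in> L"
        using w_Pos by (auto simp: Conv_def)
      then have xn: "w x \<noteq> 0" by auto
      obtain p where p: "p \<in> P - {\<zero>}" "u = lead (w p)" using u by (auto simp: L_def)
      \<comment> \<open>The lead of \<open>w x\<close> is below every index of its support, in
        particular below u, which is the lead of the element p of P.\<close>
      have "(lead (w x), lead (w p)) \<in> U" using Pos_lead(2)[OF w_Pos[OF xc(1)] xn] u p by auto
      then show ?thesis using primeideal_lead_closed[OF P _ _ nz[OF p(1)] xc(1) xn] p(1) by simp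
    qed simp
  qed
  with LF L show ?thesis by (rule that)
qed

lemma cut_order_isomorphic_spec_order: "order_isomorphic (cut_order U) (spec_order R)"
proof -
  define f :: "'a set \<times> 'a set \<Rightarrow> 'r set" where "f A = prime_of (fst A)" for A
  have f_in: "f A \<in> prime_spectrum R" if "A \<in> cuts U" for A
  proof -
    have "initial (fst A)" using cuts_down[OF linear that] by (rule initialI)
    then show ?thesis using primeideal_prime_of by (simp add: f_def prime_spectrum_eq)
  qed
  have f_iff: "f A \<subseteq> f B \<longleftrightarrow> fst A \<subseteq> fst B" if "A \<in> cuts U" "B \<in> cuts U" for A B
    unfolding f_def using prime_of_subset_iff fst_cuts_subset[OF that(1)] by blast
  have "inj_on f (cuts U)"
  proof (rule inj_onI)
    fix A B assume *: "A \<in> cuts U" "B \<in> cuts U" "f A = f B"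
    then have "fst A = fst B" using f_iff[of A B] f_iff[of B A] by blast
    then show "A = B" by (rule cuts_eqI[OF *(1,2)])
  qed
  moreover have "P \<in> f ` cuts U" if "P \<in> prime_spectrum R" for P
  proof -
    have "primeideal P R" using that prime_spectrum_eq by blast
    then obtain L where L: "L \<subseteq> Field U" "initial L" "P = prime_of L"
      by (rule primeideal_eq_prime_of)
    obtain A where "A \<in> cuts U" "fst A = L"
      by (rule ex_cut_fst[OF linear L(1)]) (auto intro: initialD[OF L(2)])
    then show ?thesis using L(3) by (auto simp: f_def)
  qed
  ultimately have "bij_betw f (cuts U) (prime_spectrum R)"
    using f_in unfolding bij_betw_def by blast
  moreover have "(A, B) \<in> cut_order U \<longleftrightarrow> (f A, f B) \<in> spec_order R"
    if "A \<in> cuts U" "B \<in> cuts U" for A B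
    using f_iff[OF that] f_in that by (simp add: in_cut_order_iff in_spec_order_iff)
  ultimately show ?thesis unfolding order_isomorphic_def by auto
qed

text \<open>
  Immediate neighbors correspond to initial segments that differ by one element \<open>u\<close>; the
  coefficient at \<open>u\<close> is then the discrete valuation of rank one.
\<close>

lemma immediate_neighbors_prime_of:
  assumes n: "immediate_neighbors (spec_order R) P2 P1"
  obtains u where "u \<in> Field U" "P1 = prime_of {x. (x, u) \<in> U}"
    "P2 = prime_of {x. (x, u) \<in> U \<and> x \<noteq> u}"
proof -
  have P: "primeideal P1 R" "primeideal P2 R" "P2 \<subseteq> P1" "P1 \<noteq> P2"
    using n by (auto simp: immediate_neighbors_def in_spec_order_iff prime_spectrum_eq)
  note trans = Linear_order_trans[OF linear] and antisym = Linear_order_antisym[OF linear]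
  obtain L1 where L1: "L1 \<subseteq> Field U" "initial L1" "P1 = prime_of L1"
    using primeideal_eq_prime_of[OF P(1)] by blast
  obtain L2 where L2: "L2 \<subseteq> Field U" "initial L2" "P2 = prime_of L2"
    using primeideal_eq_prime_of[OF P(2)] by blast
  have "L2 \<subseteq> L1" "L1 \<noteq> L2" using P(3,4) L1(3) L2(3) prime_of_subset_iff[OF L2(1), of L1] by auto
  then obtain u where u: "u \<in> L1" "u \<notin> L2" by blast
  have between: "L = L1 \<or> L = L2"
    if L: "L2 \<subseteq> L" "L \<subseteq> L1" "initial L" for L
  proof -
    have LF: "L \<subseteq> Field U" using L L1 by blast
    have "prime_of L \<in> prime_spectrum R" using primeideal_prime_of[OF L(3)] prime_spectrum_eq by blast
    moreover have "prime_of L2 \<subseteq> prime_of L" "prime_of L \<subseteq> prime_of L1"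
      using prime_of_subset_iff L LF L2(1) by blast+
    moreover have "P1 \<in> prime_spectrum R" "P2 \<in> prime_spectrum R" using P prime_spectrum_eq by auto
    ultimately have "prime_of L = prime_of L1 \<or> prime_of L = prime_of L2"
      using n L1(3) L2(3) unfolding immediate_neighbors_def in_spec_order_iff by blast
    then show ?thesis
      using prime_of_subset_iff[OF LF] prime_of_subset_iff[OF L1(1)] prime_of_subset_iff[OF L2(1)]
      by (metis subset_antisym order_refl)
  qed
  have uF: "u \<in> Field U" using u L1 by blast
  have L2u: "(x, u) \<in> U \<and> x \<noteq> u" if "x \<in> L2" for x
  proof -
    have "x \<in> Field U" "\<not> (u, x) \<in> U" using that L2(1) initialD[OF L2(2) that] u(2) by blast+
    then show ?thesis using Linear_order_total[OF linear, of u x] uF u that by blast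
  qed
  \<comment> \<open>The segments up to u, with and without u, both lie between \<open>L2\<close> and
    \<open>L1\<close>. The one containing u cannot be \<open>L2\<close>, the other cannot be
    \<open>L1\<close>.\<close>
  have "{x. (x, u) \<in> U} = L1 \<or> {x. (x, u) \<in> U} = L2"
  proof (rule between)
    show "initial {x. (x, u) \<in> U}" by (rule initialI) (auto intro: trans)
  qed (use L2u initialD[OF L1(2) u(1)] in auto)
  then have e1: "{x. (x, u) \<in> U} = L1" using u Linear_order_refl[OF linear uF] by blast
  have "{x. (x, u) \<in> U \<and> x \<noteq> u} = L1 \<or> {x. (x, u) \<in> U \<and> x \<noteq> u} = L2"
  proof (rule between)
    show "initial {x. (x, u) \<in> U \<and> x \<noteq> u}"
    proof (rule initialI)
      fix x y assume *: "y \<in> {x. (x, u) \<in> U \<and> x \<noteq> u}" "(x, y) \<in> U"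
      then have "x \<noteq> u" using antisym[of u y] by auto
      then show "x \<in> {x. (x, u) \<in> U \<and> x \<noteq> u}" using * trans[of x y u] by auto
    qed
  qed (use L2u initialD[OF L1(2) u(1)] in auto)
  then have e2: "{x. (x, u) \<in> U \<and> x \<noteq> u} = L2" using u by blast
  show ?thesis using that[OF uF] e1 e2 L1(3) L2(3) by blast
qed

lemma discrete_valuation_domain: "discrete_valuation_domain R"
  unfolding discrete_valuation_domain_def
proof (intro conjI allI impI valuation_domain)
  fix P1 P2 assume n: "immediate_neighbors (spec_order R) P2 P1"
  then have P: "primeideal P1 R" "primeideal P2 R" "P2 \<subseteq> P1"
    unfolding immediate_neighbors_def in_spec_order_iff prime_spectrum_eq by blast+
  obtain u where u: "u \<in> Field U" and P1: "P1 = prime_of {x. (x, u) \<in> U}"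
    and P2: "P2 = prime_of {x. (x, u) \<in> U \<and> x \<noteq> u}"
    using immediate_neighbors_prime_of[OF n] by blast
  define L where "L = {x. (x, u) \<in> U \<and> x \<noteq> u}"
  have L: "initial L"
  proof (rule initialI)
    fix x y assume *: "y \<in> L" "(x, y) \<in> U"
    then have "x \<noteq> u" using Linear_order_antisym[OF linear, of u y] by (auto simp: L_def)
    then show "x \<in> L" using * Linear_order_trans[OF linear, of x y u] by (auto simp: L_def)
  qed
  have L1: "{x. (x, u) \<in> U} = insert u L"
    using Linear_order_refl[OF linear u] by (auto simp: L_def)
  have notP2: "x \<in> carrier R - P2 \<longleftrightarrow> x \<in> carrier R - {\<zero>} \<and> w x \<in> Conv L" for x
    by (auto simp: P2 prime_of_def L_def)
  \<comment> \<open>Values of elements outside \<open>P2\<close> have support from u upwards, so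
    their coefficient at u is nonnegative and \<open>nat\<close> in the definition of
    \<open>m\<close> loses nothing.\<close>
  have nonneg: "Poly_Mapping.lookup \<gamma> u \<ge> 0" if "\<gamma> \<in> Conv L" for \<gamma>
  proof (rule Pos_coeff_nonneg)
    show "\<gamma> \<in> Pos" using that by (simp add: Conv_def)
    fix x assume x: "x \<in> Poly_Mapping.keys \<gamma>"
    then have "x \<notin> L" "x \<in> Field U" using that Pos_keys by (auto simp: Conv_def)
    then show "(u, x) \<in> U" using Linear_order_total[OF linear u, of x] Linear_order_refl[OF linear u]
      by (auto simp: L_def)
  qed
  define m where "m x = nat (Poly_Mapping.lookup (w x) u)" for x
  show "discrete_rank_one_valuation_domain (localization_at (R Quot P2) ((+>) P2 ` P1))"
  proof (rule discrete_rank_one_quotient_localization[OF P, of m])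
    fix k
    have "Poly_Mapping.single u (int k) \<in> Conv L"
    proof (cases "k = 0")
      case False
      then show ?thesis using single_in_Pos[OF u, of "int k"] by (auto simp: Conv_def L_def)
    qed simp
    moreover from this obtain x where x: "x \<in> carrier R - {\<zero>}" "w x = Poly_Mapping.single u (int k)"
      using w_surj unfolding Conv_def by blast
    ultimately have "x \<in> carrier R - P2" unfolding notP2 by simp
    moreover have "m x = k" using x by (simp add: m_def)
    ultimately show "\<exists>x\<in>carrier R - P2. m x = k" by blast
  next
    fix x y assume xy: "x \<in> carrier R - P2" "y \<in> carrier R - P2"
    then have xy': "x \<in> carrier R - {\<zero>}" "y \<in> carrier R - {\<zero>}"
      and C: "w x \<in> Conv L" "w y \<in> Conv L" using notP2 by blast+
    show "m (x \<otimes> y) = m x + m y"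
      using nonneg[OF C(1)] nonneg[OF C(2)] by (simp add: m_def w_mult[OF xy'] lookup_add nat_add_distrib)
    assume s: "x \<oplus> y \<notin> P2"
    then have s': "x \<oplus> y \<in> carrier R - P2" "x \<oplus> y \<noteq> \<zero>" "w (x \<oplus> y) \<in> Conv L"
      using xy' notP2[of "x \<oplus> y"] by auto
    have le: "Poly_Mapping.lookup (w z) u \<le> Poly_Mapping.lookup (w (x \<oplus> y)) u"
      if "w z \<in> Pos" "w (x \<oplus> y) - w z \<in> Pos" for z
    proof -
      \<comment> \<open>The difference is a summand, inside the cone, of an element of
        \<open>Conv L\<close>; convexity puts it into \<open>Conv L\<close>, where coefficients at u
        are nonnegative.\<close>
      have "w (x \<oplus> y) - w z \<in> Conv L"
        using Conv_add[OF L that] s'(3) by simp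
      then show ?thesis using nonneg by (fastforce simp: lookup_minus)
    qed
    show "min (m x) (m y) \<le> m (x \<oplus> y)"
      using w_add[OF xy' s'(2)] le[OF w_Pos[OF xy'(1)]] le[OF w_Pos[OF xy'(2)]]
      unfolding m_def by (auto simp: min_le_iff_disj nat_mono)
  next
    fix x assume x: "x \<in> carrier R - P2"
    then have x': "x \<in> carrier R - {\<zero>}" "w x \<in> Conv L" using notP2 by blast+
    have "m x = 0 \<longleftrightarrow> Poly_Mapping.lookup (w x) u = 0" using nonneg[OF x'(2)] by (auto simp: m_def)
    \<comment> \<open>A zero coefficient at u means that the support avoids u as well as L, and
      \<open>insert u L\<close> is the segment of \<open>P1\<close>.\<close>
    also have "\<dots> \<longleftrightarrow> w x \<in> Conv (insert u L)"
      using x'(2) by (auto simp: Conv_def in_keys_iff)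
    also have "\<dots> \<longleftrightarrow> x \<notin> P1" unfolding P1 L1 using x' by (auto simp: prime_of_def)
    finally show "m x = 0 \<longleftrightarrow> x \<notin> P1" .
  qed (rule dvd_total)
qed

end

section \<open>Existence of lexicographically valued domains\<close>

lemma single_nonzero: "c \<noteq> 0 \<Longrightarrow> Poly_Mapping.single k c \<noteq> 0"
  by (metis lookup_single_eq lookup_zero)

context lex_order
begin

text \<open>The order of exponents as a relation, so that \<open>Linear_order_finite_least\<close>,
  which produced leading indices, also produces least exponents.\<close>

definition pos_rel :: "('a \<Rightarrow>\<^sub>0 int) rel" where
  "pos_rel = {(\<alpha>, \<beta>). \<alpha> \<in> Pos \<and> \<beta> \<in> Pos \<and> \<beta> - \<alpha> \<in> Pos}"

lemma Field_pos_rel: "Field pos_rel = Pos"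
proof
  show "Pos \<subseteq> Field pos_rel"
  proof
    fix \<alpha> assume "\<alpha> \<in> Pos"
    then have "(\<alpha>, \<alpha>) \<in> pos_rel" by (simp add: pos_rel_def)
    then show "\<alpha> \<in> Field pos_rel" by (rule FieldI1)
  qed
qed (auto simp: Field_def pos_rel_def)

lemma Linear_order_pos_rel: "Linear_order pos_rel"
  unfolding linear_order_on_def partial_order_on_def preorder_on_def Field_pos_rel
proof (intro conjI)
  show "pos_rel \<subseteq> Pos \<times> Pos" by (auto simp: pos_rel_def)
  show "refl_on Pos pos_rel" by (auto simp: refl_on_def pos_rel_def)
  show "trans pos_rel" by (auto simp: trans_def pos_rel_def intro: Pos_trans)
  show "antisym pos_rel" by (auto simp: antisym_def pos_rel_def intro: Pos_antisym)
  show "total_on Pos pos_rel" using Pos_total by (auto simp: total_on_def pos_rel_def)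
qed

text \<open>The product of finitely supported maps is convolution, so this is the monoid algebra of
  \<open>Pos\<close>.\<close>

definition poly_ring :: "(('a \<Rightarrow>\<^sub>0 int) \<Rightarrow>\<^sub>0 rat) ring" where
  "poly_ring = \<lparr>carrier = {f. Poly_Mapping.keys f \<subseteq> Pos}, mult = (*), one = 1, zero = 0, add = (+)\<rparr>"

definition val :: "(('a \<Rightarrow>\<^sub>0 int) \<Rightarrow>\<^sub>0 rat) \<Rightarrow> ('a \<Rightarrow>\<^sub>0 int)" where
  "val f = (THE \<alpha>. \<alpha> \<in> Poly_Mapping.keys f \<and> (\<forall>\<beta>\<in>Poly_Mapping.keys f. \<beta> - \<alpha> \<in> Pos))"

lemma val_eqI:
  assumes "\<alpha> \<in> Poly_Mapping.keys f" "\<And>\<beta>. \<beta> \<in> Poly_Mapping.keys f \<Longrightarrow> \<beta> - \<alpha> \<in> Pos"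
  shows "val f = \<alpha>"
  unfolding val_def using assms by (blast intro: the_equality Pos_antisym)

lemma val_props:
  assumes "f \<in> carrier poly_ring" "f \<noteq> 0"
  shows "val f \<in> Poly_Mapping.keys f" "\<And>\<beta>. \<beta> \<in> Poly_Mapping.keys f \<Longrightarrow> \<beta> - val f \<in> Pos" "val f \<in> Pos"
proof -
  have f: "Poly_Mapping.keys f \<subseteq> Pos" using assms(1) by (simp add: poly_ring_def)
  obtain \<alpha> where \<alpha>: "\<alpha> \<in> Poly_Mapping.keys f" "\<forall>\<beta>\<in>Poly_Mapping.keys f. (\<alpha>, \<beta>) \<in> pos_rel"
    using Linear_order_finite_least[OF Linear_order_pos_rel, of "Poly_Mapping.keys f"] f assms(2)
    by (auto simp: Field_pos_rel)
  then have "val f = \<alpha>" using val_eqI[of \<alpha> f] by (auto simp: pos_rel_def)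
  then show "val f \<in> Poly_Mapping.keys f" "\<And>\<beta>. \<beta> \<in> Poly_Mapping.keys f \<Longrightarrow> \<beta> - val f \<in> Pos" "val f \<in> Pos"
    using \<alpha> f by (auto simp: pos_rel_def)
qed

lemma val_single: "c \<noteq> 0 \<Longrightarrow> val (Poly_Mapping.single \<gamma> c) = \<gamma>"
  by (rule val_eqI) auto

lemma single_in_poly_ring: "\<gamma> \<in> Pos \<Longrightarrow> Poly_Mapping.single \<gamma> c \<in> carrier poly_ring"
  by (simp add: poly_ring_def)

lemma poly_ring_mult_closed:
  assumes "f \<in> carrier poly_ring" "g \<in> carrier poly_ring"
  shows "f * g \<in> carrier poly_ring"
  using keys_mult[of f g] assms Pos_add unfolding poly_ring_def by fastforce

text \<open>The lowest terms of the two factors do not cancel in the product.\<close>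

lemma val_mult:
  assumes f: "f \<in> carrier poly_ring" "f \<noteq> 0" and g: "g \<in> carrier poly_ring" "g \<noteq> 0"
  shows "f * g \<noteq> 0" "val (f * g) = val f + val g"
proof -
  note vf = val_props[OF f] and vg = val_props[OF g]
  \<comment> \<open>The lowest terms of f and g are split off; it suffices that no other product of
    terms has the exponent a + b.\<close>
  define a b c d where "a = val f" and "b = val g"
    and "c = Poly_Mapping.lookup f a" and "d = Poly_Mapping.lookup g b"
  define f' g' where "f' = f - Poly_Mapping.single a c" and "g' = g - Poly_Mapping.single b d"
  have kf: "Poly_Mapping.keys f' = Poly_Mapping.keys f - {a}"
    by (auto simp: f'_def c_def in_keys_iff lookup_minus lookup_single when_def split: if_splits)
  have kg: "Poly_Mapping.keys g' = Poly_Mapping.keys g - {b}"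
    by (auto simp: g'_def d_def in_keys_iff lookup_minus lookup_single when_def split: if_splits)
  have "f * g = Poly_Mapping.single a c * Poly_Mapping.single b d
      + (Poly_Mapping.single a c * g' + f' * g)"
    unfolding f'_def g'_def by (simp add: algebra_simps)
  then have fg: "f * g = Poly_Mapping.single (a + b) (c * d)
      + (Poly_Mapping.single a c * g' + f' * g)" by (simp add: mult_single)
  have "a + b \<notin> Poly_Mapping.keys (Poly_Mapping.single a c * g')"
    using keys_mult[of "Poly_Mapping.single a c" g'] kg by (auto split: if_splits)
  moreover have "a + b \<notin> Poly_Mapping.keys (f' * g)"
  proof
    assume "a + b \<in> Poly_Mapping.keys (f' * g)"
    then obtain x y where xy: "a + b = x + y" "x \<in> Poly_Mapping.keys f'" "y \<in> Poly_Mapping.keys g"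
      using keys_mult[of f' g] by blast
    then have "x - a \<in> Pos" "y - b \<in> Pos" using vf vg kf by (auto simp: a_def b_def)
    \<comment> \<open>Both x - a and its negative y - b are in the cone, which forces x = a, an
      exponent removed from f'.\<close>
    moreover have "y - b = a - x" using xy(1) by (simp add: algebra_simps)
    ultimately have "x = a" by (intro Pos_antisym) simp_all
    then show False using xy(2) kf by simp
  qed
  ultimately have "Poly_Mapping.lookup (f * g) (a + b) = c * d"
    unfolding fg by (simp add: lookup_add in_keys_iff)
  moreover have "c \<noteq> 0" "d \<noteq> 0"
    using vf(1) vg(1) by (simp_all add: a_def b_def c_def d_def in_keys_iff)
  ultimately have *: "a + b \<in> Poly_Mapping.keys (f * g)" by (simp add: in_keys_iff)
  then show "f * g \<noteq> 0" by auto
  show "val (f * g) = val f + val g"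
    unfolding a_def[symmetric] b_def[symmetric]
  proof (rule val_eqI[OF *])
    fix \<beta> assume "\<beta> \<in> Poly_Mapping.keys (f * g)"
    then obtain x y where xy: "\<beta> = x + y" "x \<in> Poly_Mapping.keys f" "y \<in> Poly_Mapping.keys g"
      using keys_mult[of f g] by blast
    then have "(x - a) + (y - b) \<in> Pos" using vf vg by (intro Pos_add) (auto simp: a_def b_def)
    moreover have "\<beta> - (a + b) = (x - a) + (y - b)" using xy(1) by (simp add: algebra_simps)
    ultimately show "\<beta> - (a + b) \<in> Pos" by (simp only:)
  qed
qed

lemma val_add:
  assumes "f \<in> carrier poly_ring" "f \<noteq> 0" "g \<in> carrier poly_ring" "g \<noteq> 0"
    and "f + g \<in> carrier poly_ring" "f + g \<noteq> 0"
  shows "val (f + g) - val f \<in> Pos \<or> val (f + g) - val g \<in> Pos"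
  using val_props(1)[OF assms(5,6)] keys_add[of f g]
    val_props(2)[OF assms(1,2)] val_props(2)[OF assms(3,4)] by blast

text \<open>Shifting all exponents down by the least one stays in the cone, although the shifting
  monomial itself need not. The cofactor becomes a unit after localization.\<close>

lemma factor_single_val:
  assumes f: "f \<in> carrier poly_ring" "f \<noteq> 0"
  obtains g where "g \<in> carrier poly_ring" "g \<noteq> 0" "val g = 0" "f = Poly_Mapping.single (val f) 1 * g"
proof -
  define g where "g = Poly_Mapping.single (- val f) 1 * f"
  have fg: "f = Poly_Mapping.single (val f) 1 * g"
    by (simp add: g_def mult_single flip: mult.assoc)
  have "Poly_Mapping.keys g \<subseteq> Pos"
    using keys_mult[of "Poly_Mapping.single (- val f) 1" f] val_props(2)[OF f]
    unfolding g_def by fastforce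
  then have g: "g \<in> carrier poly_ring" by (simp add: poly_ring_def)
  have nz: "g \<noteq> 0" using fg f by auto
  have "Poly_Mapping.single (val f) (1::rat) \<noteq> 0"
    by (simp add: single_nonzero)
  then have "val f = val f + val g"
    using val_mult(2)[OF single_in_poly_ring[OF val_props(3)[OF f], of 1] _ g nz] fg
    by (simp add: val_single)
  then have "val g = 0" by simp
  with g nz show ?thesis using fg by (rule that)
qed

lemma domain_poly_ring: "domain poly_ring"
proof (rule domain.intro)
  have "abelian_group poly_ring"
  proof (rule abelian_groupI)
    fix f g assume "f \<in> carrier poly_ring" "g \<in> carrier poly_ring"
    then show "f \<oplus>\<^bsub>poly_ring\<^esub> g \<in> carrier poly_ring"
      using keys_add[of f g] by (auto simp: poly_ring_def)
  next
    fix f assume "f \<in> carrier poly_ring"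
    then have "- f \<in> carrier poly_ring" "- f \<oplus>\<^bsub>poly_ring\<^esub> f = \<zero>\<^bsub>poly_ring\<^esub>"
      by (auto simp: poly_ring_def)
    then show "\<exists>g\<in>carrier poly_ring. g \<oplus>\<^bsub>poly_ring\<^esub> f = \<zero>\<^bsub>poly_ring\<^esub>" by blast
  qed (auto simp: poly_ring_def algebra_simps)
  moreover have "comm_monoid poly_ring"
  proof (rule comm_monoidI)
    fix f g assume "f \<in> carrier poly_ring" "g \<in> carrier poly_ring"
    then show "f \<otimes>\<^bsub>poly_ring\<^esub> g \<in> carrier poly_ring"
      using poly_ring_mult_closed by (simp add: poly_ring_def)
  qed (auto simp: poly_ring_def algebra_simps)
  ultimately show "cring poly_ring"
    by (rule cringI) (simp add: poly_ring_def algebra_simps)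
  show "domain_axioms poly_ring"
  proof
    show "\<one>\<^bsub>poly_ring\<^esub> \<noteq> \<zero>\<^bsub>poly_ring\<^esub>" by (simp add: poly_ring_def)
    fix f g assume "f \<otimes>\<^bsub>poly_ring\<^esub> g = \<zero>\<^bsub>poly_ring\<^esub>" "f \<in> carrier poly_ring" "g \<in> carrier poly_ring"
    then show "f = \<zero>\<^bsub>poly_ring\<^esub> \<or> g = \<zero>\<^bsub>poly_ring\<^esub>"
      using val_mult(1)[of f g] by (auto simp: poly_ring_def)
  qed
qed

text \<open>As 0 is the least exponent in the cone, these are exactly the elements with nonzero
  constant coefficient.\<close>

definition val_zero :: "(('a \<Rightarrow>\<^sub>0 int) \<Rightarrow>\<^sub>0 rat) set" where
  "val_zero = {f \<in> carrier poly_ring. f \<noteq> 0 \<and> val f = 0}"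

lemma domain_fractions_poly_ring: "domain_fractions poly_ring val_zero"
proof (rule domain_fractions.intro[OF domain_poly_ring])
  have z: "\<zero>\<^bsub>poly_ring\<^esub> = 0" and o: "\<one>\<^bsub>poly_ring\<^esub> = Poly_Mapping.single 0 1"
    and m: "f \<otimes>\<^bsub>poly_ring\<^esub> g = f * g" for f g
    by (simp_all add: poly_ring_def)
  show "domain_fractions_axioms poly_ring val_zero"
  proof
    show "\<one>\<^bsub>poly_ring\<^esub> \<in> val_zero"
      unfolding o val_zero_def using val_single[of 1 0] single_in_poly_ring[of 0 1] by simp
  qed (auto simp: val_zero_def z m val_mult poly_ring_mult_closed)
qed

text \<open>Denominators have value 0, so the value of a/s is that of a. The localization is needed
  for divisibility: only there do elements of equal value differ by a unit.\<close>

lemma ex_lex_valued_domain: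
  "\<exists>w. lex_valued_domain U (ring_of_fractions poly_ring val_zero) w"
proof -
  interpret fr: domain_fractions poly_ring val_zero by (rule domain_fractions_poly_ring)
  have ops: "\<zero>\<^bsub>poly_ring\<^esub> = 0" "f \<otimes>\<^bsub>poly_ring\<^esub> g = f * g" "f \<oplus>\<^bsub>poly_ring\<^esub> g = f + g" for f g
    by (simp_all add: poly_ring_def)
  have S_iff: "s \<in> val_zero \<longleftrightarrow> s \<in> carrier poly_ring - {0} \<and> val s = 0" for s
    unfolding val_zero_def by blast
  have nz_mult: "f * g \<in> carrier poly_ring - {0}"
    if "f \<in> carrier poly_ring - {0}" "g \<in> carrier poly_ring - {0}" for f g
    using that val_mult(1) poly_ring_mult_closed by blast
  have vm: "val (f * g) = val f + val g"
    if "f \<in> carrier poly_ring - {0}" "g \<in> carrier poly_ring - {0}" for f g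
    using that val_mult(2) by blast
  define w where
    "w X = (SOME \<gamma>. \<exists>a\<in>carrier poly_ring - {0}. \<exists>s\<in>val_zero. X = fr.frac a s \<and> \<gamma> = val a)" for X
  have w: "w (fr.frac a s) = val a" if as: "a \<in> carrier poly_ring - {0}" "s \<in> val_zero" for a s
    unfolding w_def
  proof (rule some_equality)
    show "\<exists>b\<in>carrier poly_ring - {0}. \<exists>t\<in>val_zero. fr.frac a s = fr.frac b t \<and> val a = val b"
      using as by blast
    fix \<gamma> assume "\<exists>b\<in>carrier poly_ring - {0}. \<exists>t\<in>val_zero. fr.frac a s = fr.frac b t \<and> \<gamma> = val b"
    then obtain b t where bt: "b \<in> carrier poly_ring - {0}" "t \<in> val_zero"
      "fr.frac a s = fr.frac b t" "\<gamma> = val b"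
      by blast
    then have "a * t = b * s" using as by (simp add: fr.frac_eq_iff ops)
    then have "val a + val t = val b + val s" using vm as bt(1,2) S_iff by metis
    moreover have "val s = 0" "val t = 0" using as(2) bt(2) S_iff by blast+
    ultimately show "\<gamma> = val a" using bt(4) by simp
  qed
  have frac_nz: "\<exists>a\<in>carrier poly_ring - {0}. \<exists>s\<in>val_zero. X = fr.frac a s"
    if "X \<in> carrier fr.F - {\<zero>\<^bsub>fr.F\<^esub>}" for X
  proof -
    have "X \<in> carrier fr.F" using that by simp
    then obtain a s where as: "a \<in> carrier poly_ring" "s \<in> val_zero" "X = fr.frac a s"
      by (rule fr.in_carrier_frac)
    with that have "a \<noteq> 0" using fr.frac_eq_zero_iff[of a s] by (auto simp: ops)
    with as show ?thesis by blast
  qed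
  interpret F: "domain" fr.F by (rule fr.domain_ring_of_fractions)
  have "lex_valued_domain U fr.F w"
  proof
    fix X assume "X \<in> carrier fr.F - {\<zero>\<^bsub>fr.F\<^esub>}"
    then show "w X \<in> Pos" using frac_nz[of X] w val_props(3) by auto
  next
    fix \<gamma> :: "'a \<Rightarrow>\<^sub>0 int" assume \<gamma>: "\<gamma> \<in> Pos"
    let ?f = "Poly_Mapping.single \<gamma> (1::rat)"
    have f: "?f \<in> carrier poly_ring - {0}" using single_in_poly_ring[OF \<gamma>] by (simp add: single_nonzero)
    have "fr.frac ?f \<one>\<^bsub>poly_ring\<^esub> \<in> carrier fr.F - {\<zero>\<^bsub>fr.F\<^esub>}"
      using f by (auto simp: fr.frac_eq_zero_iff ops)
    moreover have "w (fr.frac ?f \<one>\<^bsub>poly_ring\<^esub>) = \<gamma>" using w[OF f fr.one_in_S] by (simp add: val_single)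
    ultimately show "\<exists>X\<in>carrier fr.F - {\<zero>\<^bsub>fr.F\<^esub>}. w X = \<gamma>" by blast
  next
    fix X Y assume "X \<in> carrier fr.F - {\<zero>\<^bsub>fr.F\<^esub>}" "Y \<in> carrier fr.F - {\<zero>\<^bsub>fr.F\<^esub>}"
    then obtain a s b t where *: "a \<in> carrier poly_ring - {0}" "s \<in> val_zero"
      "b \<in> carrier poly_ring - {0}" "t \<in> val_zero"
      and X: "X = fr.frac a s" "Y = fr.frac b t" using frac_nz by meson
    have st: "s \<in> carrier poly_ring - {0}" "t \<in> carrier poly_ring - {0}" "val s = 0" "val t = 0"
      using *(2,4) unfolding S_iff by blast+
    have m: "s * t \<in> val_zero"
      using fr.S_mult[OF *(2,4)] by (simp add: ops)
    have "X \<otimes>\<^bsub>fr.F\<^esub> Y = fr.frac (a * b) (s * t)" using * by (simp add: X fr.frac_mult ops)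
    then show "w (X \<otimes>\<^bsub>fr.F\<^esub> Y) = w X + w Y"
      using w[OF nz_mult[OF *(1,3)] m] w[OF *(1,2)] w[OF *(3,4)] vm[OF *(1,3)] by (simp add: X)
    assume nz: "X \<oplus>\<^bsub>fr.F\<^esub> Y \<noteq> \<zero>\<^bsub>fr.F\<^esub>"
    have eq: "X \<oplus>\<^bsub>fr.F\<^esub> Y = fr.frac (a * t + b * s) (s * t)" using * by (simp add: X fr.frac_add ops)
    have c: "a * t + b * s \<in> carrier poly_ring"
      using fr.a_closed[of "a * t" "b * s"] nz_mult[OF *(1) st(2)] nz_mult[OF *(3) st(1)] by (simp add: ops)
    have nz': "a * t + b * s \<noteq> 0"
      using nz fr.frac_eq_zero_iff[OF c m] unfolding eq by (simp add: ops)
    have "val (a * t + b * s) - val (a * t) \<in> Pos \<or> val (a * t + b * s) - val (b * s) \<in> Pos"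
      using val_add[OF _ _ _ _ c nz'] nz_mult[OF *(1) st(2)] nz_mult[OF *(3) st(1)] by blast
    then show "w (X \<oplus>\<^bsub>fr.F\<^esub> Y) - w X \<in> Pos \<or> w (X \<oplus>\<^bsub>fr.F\<^esub> Y) - w Y \<in> Pos"
      using w[of "a * t + b * s" "s * t"] c nz' m w[OF *(1,2)] w[OF *(3,4)]
        vm[OF *(1) st(2)] vm[OF *(3) st(1)] st(3,4) unfolding eq by (simp add: X)
  next
    fix X Y assume XY: "X \<in> carrier fr.F - {\<zero>\<^bsub>fr.F\<^esub>}" "Y \<in> carrier fr.F - {\<zero>\<^bsub>fr.F\<^esub>}"
      and le: "w Y - w X \<in> Pos"
    then obtain a s b t where *: "a \<in> carrier poly_ring - {0}" "s \<in> val_zero"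
      "b \<in> carrier poly_ring - {0}" "t \<in> val_zero"
      and X: "X = fr.frac a s" "Y = fr.frac b t" using frac_nz by meson
    obtain a' where a': "a' \<in> val_zero" "a = Poly_Mapping.single (val a) 1 * a'"
      using factor_single_val[of a] *(1) unfolding val_zero_def by blast
    obtain b' where b': "b' \<in> val_zero" "b = Poly_Mapping.single (val b) 1 * b'"
      using factor_single_val[of b] *(3) unfolding val_zero_def by blast
    \<comment> \<open>With a and b written as monomials times a' and b', the monomial e is the
      quotient of the two monomials; the cofactor of a/s in b/t is then e b' s / (a' t).\<close>
    define e where "e = Poly_Mapping.single (val b - val a) (1::rat)"
    have e: "e \<in> carrier poly_ring"
      using le *  unfolding e_def by (intro single_in_poly_ring) (simp add: X w)
    have b: "b = Poly_Mapping.single (val a) 1 * e * b'"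
      using b'(2) by (simp add: e_def mult_single)
    have z: "e * b' * s \<in> carrier poly_ring" "a' * t \<in> val_zero" "s * (a' * t) \<in> val_zero"
      using e b'(1) *(2,4) a'(1) poly_ring_mult_closed fr.S_mult fr.S_carrier by (auto simp: ops)
    have "b * (s * (a' * t)) = a * (e * b' * s) * t"
      by (subst b, subst (2) a'(2)) (simp add: mult_ac)
    then have "Y = X \<otimes>\<^bsub>fr.F\<^esub> fr.frac (e * b' * s) (a' * t)"
      using * z poly_ring_mult_closed by (simp add: X fr.frac_mult fr.frac_eq_iff ops)
    then show "\<exists>Z\<in>carrier fr.F. Y = X \<otimes>\<^bsub>fr.F\<^esub> Z" using fr.frac_in_carrier[OF z(1,2)] by blast
  qed
  then show ?thesis by blast
qed

end

text \<open>The ring structure is copied to the image of h. This moves the localization, whose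
  elements are classes of pairs, to the type prescribed for the witness.\<close>

lemma lex_valued_domain_transport:
  fixes R :: "('r, 'm) ring_scheme" and h :: "'r \<Rightarrow> 's"
  assumes R: "lex_valued_domain U R w" and h: "inj_on h (carrier R)"
  shows "\<exists>(R' :: 's ring) w'. lex_valued_domain U R' w'"
proof -
  interpret lex_valued_domain U R w by fact
  define g where "g = inv_into (carrier R) h"
  define R' where "R' = \<lparr>carrier = h ` carrier R, mult = (\<lambda>x y. h (g x \<otimes>\<^bsub>R\<^esub> g y)), one = h \<one>\<^bsub>R\<^esub>,
    zero = h \<zero>\<^bsub>R\<^esub>, add = (\<lambda>x y. h (g x \<oplus>\<^bsub>R\<^esub> g y))\<rparr>"
  have gh: "g (h x) = x" if "x \<in> carrier R" for x
    using h that by (simp add: g_def)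
  have "h \<in> ring_iso R R'"
    by (rule ring_iso_memI) (auto simp: R'_def gh bij_betw_def h)
  then have "domain (R'\<lparr>zero := h \<zero>\<^bsub>R\<^esub>\<rparr>)" by (rule ring_iso_imp_img_domain)
  then interpret R': "domain" R' by (simp add: R'_def)
  have mem: "\<exists>x'\<in>carrier R - {\<zero>\<^bsub>R\<^esub>}. x = h x'" if "x \<in> carrier R' - {\<zero>\<^bsub>R'\<^esub>}" for x
    using that by (auto simp: R'_def)
  have mem': "h x \<in> carrier R' - {\<zero>\<^bsub>R'\<^esub>}" if "x \<in> carrier R - {\<zero>\<^bsub>R\<^esub>}" for x
    using that gh by (auto simp: R'_def dest: inj_onD[OF h])
  have "lex_valued_domain U R' (w \<circ> g)"
  proof
    fix x assume "x \<in> carrier R' - {\<zero>\<^bsub>R'\<^esub>}"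
    then show "(w \<circ> g) x \<in> Pos" using mem gh w_Pos by fastforce
  next
    fix \<gamma> assume "\<gamma> \<in> Pos"
    then obtain x where "x \<in> carrier R - {\<zero>\<^bsub>R\<^esub>}" "w x = \<gamma>" using w_surj by blast
    then show "\<exists>x\<in>carrier R' - {\<zero>\<^bsub>R'\<^esub>}. (w \<circ> g) x = \<gamma>"
      using mem' gh by (intro bexI[of _ "h x"]) auto
  next
    fix x y assume "x \<in> carrier R' - {\<zero>\<^bsub>R'\<^esub>}" "y \<in> carrier R' - {\<zero>\<^bsub>R'\<^esub>}"
    then obtain x' y' where *: "x' \<in> carrier R - {\<zero>\<^bsub>R\<^esub>}" "y' \<in> carrier R - {\<zero>\<^bsub>R\<^esub>}"
      and x: "x = h x'" "y = h y'" using mem by meson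
    have m: "x \<otimes>\<^bsub>R'\<^esub> y = h (x' \<otimes>\<^bsub>R\<^esub> y')" "x \<oplus>\<^bsub>R'\<^esub> y = h (x' \<oplus>\<^bsub>R\<^esub> y')"
      and z: "\<zero>\<^bsub>R'\<^esub> = h \<zero>\<^bsub>R\<^esub>"
      using * gh by (simp_all add: R'_def x)
    show "(w \<circ> g) (x \<otimes>\<^bsub>R'\<^esub> y) = (w \<circ> g) x + (w \<circ> g) y"
      using * w_mult[OF *] by (simp add: m gh) (simp add: x gh)
    assume "x \<oplus>\<^bsub>R'\<^esub> y \<noteq> \<zero>\<^bsub>R'\<^esub>"
    then have "x' \<oplus>\<^bsub>R\<^esub> y' \<noteq> \<zero>\<^bsub>R\<^esub>" unfolding m z by auto
    from w_add[OF * this]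
    show "(w \<circ> g) (x \<oplus>\<^bsub>R'\<^esub> y) - (w \<circ> g) x \<in> Pos \<or> (w \<circ> g) (x \<oplus>\<^bsub>R'\<^esub> y) - (w \<circ> g) y \<in> Pos"
      using * by (simp add: m gh) (simp add: x gh)
  next
    fix x y assume "x \<in> carrier R' - {\<zero>\<^bsub>R'\<^esub>}" "y \<in> carrier R' - {\<zero>\<^bsub>R'\<^esub>}"
      and le: "(w \<circ> g) y - (w \<circ> g) x \<in> Pos"
    then obtain x' y' where *: "x' \<in> carrier R - {\<zero>\<^bsub>R\<^esub>}" "y' \<in> carrier R - {\<zero>\<^bsub>R\<^esub>}"
      and x: "x = h x'" "y = h y'" using mem by meson
    have "w y' - w x' \<in> Pos" using le * by (simp add: x gh)
    then obtain z where z: "z \<in> carrier R" "y' = x' \<otimes>\<^bsub>R\<^esub> z" using w_dvd[OF *] by blast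
    then have "y = x \<otimes>\<^bsub>R'\<^esub> h z" "h z \<in> carrier R'" using * by (simp_all add: R'_def x gh)
    then show "\<exists>z\<in>carrier R'. y = x \<otimes>\<^bsub>R'\<^esub> z" by blast
  qed
  then show ?thesis by blast
qed

lemma ex_inj_poly_mapping_series:
  "\<exists>h :: (('a \<Rightarrow>\<^sub>0 int) \<Rightarrow>\<^sub>0 rat) \<Rightarrow> 'a series. inj h"
proof -
  define h :: "(('a \<Rightarrow>\<^sub>0 int) \<Rightarrow>\<^sub>0 rat) \<Rightarrow> 'a series"
    \<comment> \<open>At functions g of infinite support the value is unspecified; f is recovered
      from the values at the functions \<open>lookup\<close> of an exponent, so injectivity is
      unaffected.\<close>
    where "h f = (\<lambda>g. Poly_Mapping.lookup f (Abs_poly_mapping g))" for f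
  have "h f (Poly_Mapping.lookup \<gamma>) = Poly_Mapping.lookup f \<gamma>" for f \<gamma>
    by (simp add: h_def lookup_inverse)
  then have "inj h" by (metis injI poly_mapping_eqI)
  then show ?thesis by blast
qed

text \<open>Rational coefficients alone make the type infinite, and an infinite set is equinumerous
  with its square.\<close>

lemma ex_inj_pair_poly_mapping:
  "\<exists>h :: ('b \<Rightarrow>\<^sub>0 rat) \<times> ('b \<Rightarrow>\<^sub>0 rat) \<Rightarrow> ('b \<Rightarrow>\<^sub>0 rat). inj h"
proof -
  have "inj (\<lambda>q::rat. Poly_Mapping.single (undefined::'b) q)" by (metis injI lookup_single_eq)
  then have "infinite (UNIV :: ('b \<Rightarrow>\<^sub>0 rat) set)"
    using infinite_UNIV_char_0 finite_imageD by (metis finite_subset subset_UNIV)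
  from card_of_Times_same_infinite[OF this]
  show ?thesis using card_of_ordIso[of "(UNIV :: ('b \<Rightarrow>\<^sub>0 rat) set) \<times> UNIV" "UNIV :: ('b \<Rightarrow>\<^sub>0 rat) set"]
    by (auto simp: bij_betw_def)
qed

lemma ex_discrete_valuation_domain:
  fixes U :: "'a rel"
  assumes U: "Linear_order U"
  obtains A :: "'a series ring"
  where "discrete_valuation_domain A" "order_isomorphic (cut_order U) (spec_order A)"
proof -
  interpret lex_order U using U by unfold_locales
  interpret fr: domain_fractions poly_ring val_zero by (rule domain_fractions_poly_ring)
  obtain w where w: "lex_valued_domain U fr.F w" using ex_lex_valued_domain by blast
  \<comment> \<open>A fraction is determined by any one of its representatives, so choosing one
    injects the fractions into pairs; \<open>h1\<close> codes the pair by one element and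
    \<open>h2\<close> turns it into a series.\<close>
  define p where "p X = (SOME q. X = fr.frac (fst q) (snd q))" for X
  have p: "fr.frac (fst (p X)) (snd (p X)) = X" if X: "X \<in> carrier fr.F" for X
  proof -
    obtain a s where "X = fr.frac a s" using fr.in_carrier_frac[OF X] by blast
    then have "X = fr.frac (fst (a, s)) (snd (a, s))" by simp
    then have "X = fr.frac (fst (p X)) (snd (p X))" unfolding p_def by (rule someI)
    then show ?thesis by simp
  qed
  obtain h1 :: "(('a \<Rightarrow>\<^sub>0 int) \<Rightarrow>\<^sub>0 rat) \<times> (('a \<Rightarrow>\<^sub>0 int) \<Rightarrow>\<^sub>0 rat) \<Rightarrow> (('a \<Rightarrow>\<^sub>0 int) \<Rightarrow>\<^sub>0 rat)"
    where h1: "inj h1" using ex_inj_pair_poly_mapping by blast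
  obtain h2 :: "(('a \<Rightarrow>\<^sub>0 int) \<Rightarrow>\<^sub>0 rat) \<Rightarrow> 'a series" where h2: "inj h2"
    using ex_inj_poly_mapping_series by blast
  have "inj_on (\<lambda>X. h2 (h1 (p X))) (carrier fr.F)"
  proof (rule inj_onI)
    fix X Y assume *: "X \<in> carrier fr.F" "Y \<in> carrier fr.F" "h2 (h1 (p X)) = h2 (h1 (p Y))"
    have "p X = p Y" using injD[OF h1 injD[OF h2 *(3)]] .
    then show "X = Y" using p[OF *(1)] p[OF *(2)] by metis
  qed
  then obtain A :: "'a series ring" and w' where A: "lex_valued_domain U A w'"
    using lex_valued_domain_transport[OF w] by blast
  show ?thesis
    using that lex_valued_domain.discrete_valuation_domain[OF A]
      lex_valued_domain.cut_order_isomorphic_spec_order[OF A] by blast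
qed

section \<open>The equivalences\<close>

lemma Dedekind_imp_K1_K2:
  assumes "Linear_order U" "order_isomorphic T (cut_order U)"
  shows "K1 T \<and> K2 T"
  using assms K1_order_isomorphic K2_order_isomorphic K1_cut_order K2_cut_order by blast

lemma spec_imp_K1_K2:
  assumes "nonzero_ring A" "K2 (spec_order A)" "Linear_order (spec_order A)"
    "order_isomorphic T (spec_order A)"
  shows "K1 T \<and> K2 T"
  using assms K1_order_isomorphic K2_order_isomorphic K1_spec_order
  unfolding nonzero_ring_def by blast

lemma valuation_imp_K1_K2:
  assumes "commutative_valuation_ring A" "order_isomorphic T (spec_order A)"
  shows "K1 T \<and> K2 T"
  using assms spec_imp_K1_K2 commutative_valuation_ringD(1) K2_spec_order Linear_order_spec_order
  by blast

lemma discrete_valuation_domain_imp_commutative_valuation_ring: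
  "discrete_valuation_domain A \<Longrightarrow> commutative_valuation_ring A"
  by (simp add: discrete_valuation_domain_def valuation_domain_def)

lemma discrete_imp_K1_K2:
  assumes "discrete_valuation_domain A" "order_isomorphic T (spec_order A)"
  shows "K1 T \<and> K2 T"
  using assms valuation_imp_K1_K2 discrete_valuation_domain_imp_commutative_valuation_ring by blast

text \<open>The one place where a ring is produced: the discrete valuation domain obtained here also
  witnesses conditions (b) and (c).\<close>

lemma K1_K2_imp_discrete:
  fixes T :: "'a rel"
  assumes T: "Linear_order T" "Field T \<noteq> {}" "K1 T" "K2 T"
  obtains A :: "'a series ring"
  where "discrete_valuation_domain A" "order_isomorphic T (spec_order A)"
proof -
  obtain U :: "'a rel" where U: "Linear_order U" "order_isomorphic T (cut_order U)"
    by (rule K1_K2_imp_Dedekind[OF T])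
  obtain A :: "'a series ring"
    where "discrete_valuation_domain A" "order_isomorphic (cut_order U) (spec_order A)"
    by (rule ex_discrete_valuation_domain[OF U(1)])
  then show ?thesis using order_isomorphic_trans[OF U(2)] that by blast
qed

lemma discrete_iff_K1_K2:
  fixes T :: "'a rel"
  assumes "Linear_order T" "Field T \<noteq> {}"
  shows "(\<exists>A :: 'a series ring. discrete_valuation_domain A \<and>
      order_isomorphic T (spec_order A)) \<longleftrightarrow> K1 T \<and> K2 T"
  using K1_K2_imp_discrete[OF assms] discrete_imp_K1_K2 by metis

lemma valuation_iff_K1_K2:
  fixes T :: "'a rel"
  assumes "Linear_order T" "Field T \<noteq> {}"
  shows "(\<exists>A :: 'a series ring. commutative_valuation_ring A \<and>
      order_isomorphic T (spec_order A)) \<longleftrightarrow> K1 T \<and> K2 T"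
  using discrete_iff_K1_K2[OF assms] valuation_imp_K1_K2
    discrete_valuation_domain_imp_commutative_valuation_ring by metis

lemma linear_spec_iff_K1_K2:
  fixes T :: "'a rel"
  assumes "Linear_order T" "Field T \<noteq> {}"
  shows "(\<exists>A :: 'a series ring. nonzero_ring A \<and> K2 (spec_order A) \<and>
      Linear_order (spec_order A) \<and> order_isomorphic T (spec_order A)) \<longleftrightarrow> K1 T \<and> K2 T"
  using valuation_iff_K1_K2[OF assms] spec_imp_K1_K2
    commutative_valuation_ringD(1) K2_spec_order Linear_order_spec_order by metis

lemma Dedekind_iff_K1_K2:
  fixes T :: "'a rel"
  assumes "Linear_order T" "Field T \<noteq> {}"
  shows "(\<exists>U :: 'a rel. Linear_order U \<and> order_isomorphic T (cut_order U)) \<longleftrightarrow> K1 T \<and> K2 T"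
  using K1_K2_imp_Dedekind[OF assms] Dedekind_imp_K1_K2 by metis

(* The first block is the equivalence of (a), (b), (c), (d) with (e), with witnesses on fixed
   types.  The second block, in which 'r and 'u are arbitrary types, says that rings and totally
   ordered sets living on any other types realise no further T; so the conditions do not depend
   on the choice of the types of the witnesses. *)
theorem corollary3p9:
  fixes T :: "'a rel"
  assumes "Linear_order T" and "Field T \<noteq> {}"
  shows
   "(((\<exists>A1 :: 'a series ring. discrete_valuation_domain A1 \<and>
          order_isomorphic T (spec_order A1)) \<longleftrightarrow> K1 T \<and> K2 T) \<and>
     ((\<exists>A2 :: 'a series ring. commutative_valuation_ring A2 \<and>
          order_isomorphic T (spec_order A2)) \<longleftrightarrow> K1 T \<and> K2 T) \<and>
     ((\<exists>A3 :: 'a series ring. nonzero_ring A3 \<and>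
          K2 (spec_order A3) \<and> Linear_order (spec_order A3) \<and>
          order_isomorphic T (spec_order A3)) \<longleftrightarrow> K1 T \<and> K2 T) \<and>
     ((\<exists>U :: 'a rel. Linear_order U \<and>
          order_isomorphic T (cut_order U)) \<longleftrightarrow> K1 T \<and> K2 T))
    \<and>
    (((\<exists>A1 :: 'r ring. discrete_valuation_domain A1 \<and>
          order_isomorphic T (spec_order A1)) \<longrightarrow> K1 T \<and> K2 T) \<and>
     ((\<exists>A2 :: 'r ring. commutative_valuation_ring A2 \<and>
          order_isomorphic T (spec_order A2)) \<longrightarrow> K1 T \<and> K2 T) \<and>
     ((\<exists>A3 :: 'r ring. nonzero_ring A3 \<and>
          K2 (spec_order A3) \<and> Linear_order (spec_order A3) \<and>
          order_isomorphic T (spec_order A3)) \<longrightarrow> K1 T \<and> K2 T) \<and>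
     ((\<exists>U :: 'u rel. Linear_order U \<and>
          order_isomorphic T (cut_order U)) \<longrightarrow> K1 T \<and> K2 T))"
proof -
  have "(\<exists>A1 :: 'r ring. discrete_valuation_domain A1 \<and>
          order_isomorphic T (spec_order A1)) \<longrightarrow> K1 T \<and> K2 T"
    using discrete_imp_K1_K2 by blast
  moreover have "(\<exists>A2 :: 'r ring. commutative_valuation_ring A2 \<and>
          order_isomorphic T (spec_order A2)) \<longrightarrow> K1 T \<and> K2 T"
    using valuation_imp_K1_K2 by blast
  moreover have "(\<exists>A3 :: 'r ring. nonzero_ring A3 \<and>
          K2 (spec_order A3) \<and> Linear_order (spec_order A3) \<and>
          order_isomorphic T (spec_order A3)) \<longrightarrow> K1 T \<and> K2 T"
    using spec_imp_K1_K2 by blast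
  moreover have "(\<exists>U :: 'u rel. Linear_order U \<and>
          order_isomorphic T (cut_order U)) \<longrightarrow> K1 T \<and> K2 T"
    using Dedekind_imp_K1_K2 by blast
  ultimately show ?thesis
    using discrete_iff_K1_K2[OF assms] valuation_iff_K1_K2[OF assms]
      linear_spec_iff_K1_K2[OF assms] Dedekind_iff_K1_K2[OF assms]
    by (intro conjI[OF conjI[OF _ conjI[OF _ conjI]] conjI[OF _ conjI[OF _ conjI]]])
qed

end
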